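(* Let $A=\{\sigma_0,\sigma_1,\sigma_2,\sigma_3\}$ and let $A^*$ be the set of all finite words on $A$ (including the empty word). For $\sigma=\sigma_{k_1},\sigma_{k_2},\dots,\sigma_{k_n}\in A^*$ let $m(\sigma)=\sigma_{k_n}\cdots\sigma_{k_2}\sigma_{k_1}$ be the matrix product (the identity for the empty word). Then $$\left\{\, m(\sigma)\begin{bmatrix}1\\0\end{bmatrix} : \sigma\in A^*\right\}=\Lambda,$$ where $\Lambda$ is the set of short cylinder vectors (equivalently, long saddle connection vectors) of the golden L lying in the positive cone $\Sigma$. Furthermore, $\sigma\mapsto m(\sigma)\begin{bmatrix}1\\0\end{bmatrix}$ gives a bijection between the set of words in $A^*$ not starting with $\sigma_0$ (i.e. the empty word and the words with $k_1\neq 0$) and $\Lambda$.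
   Context: Let $\phi=(1+\sqrt5)/2$. The golden L is the translation surface obtained from the polygon $([0,\phi]\times[0,1])\cup([0,1]\times[0,\phi])$ by gluing by translation the sides $\{\phi\}\times[0,1]$ to $\{0\}\times[0,1]$, $\{1\}\times[1,\phi]$ to $\{0\}\times[1,\phi]$, $[1,\phi]\times\{1\}$ to $[1,\phi]\times\{0\}$, and $[0,1]\times\{\phi\}$ to $[0,1]\times\{0\}$. It has a single singularity, of cone angle $6\pi$. A saddle connection is a straight segment with both endpoints at the singularity and no singularity in its interior. A cylinder is a maximal family of parallel (primitive) periodic trajectories; its cylinder vector is the holonomy vector of these closed trajectories. A periodic direction is the direction of a periodic trajectory. In each periodic direction there are exactly two cylinders, a short one and a long one, with length ratio $\phi$; saddle connections in that direction have exactly two lengths (short and long), with ratio $\phi$; and the long saddle connection vector equals the short cylinder vector. $\Sigma=\{(x,y)\in\mathbb{R}^2: x>0,\ y\ge 0\}$ and $\sigma_0=\begin{bmatrix}1&\phi\\0&1\end{bmatrix}$, $\sigma_1=\begin{bmatrix}\phi&\phi\\1&\phi\end{bmatrix}$, $\sigma_2=\begin{bmatrix}\phi&1\\\phi&\phi\end{bmatrix}$, $\sigma_3=\begin{bmatrix}1&0\\\phi&1\end{bmatrix}$. *)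

theory Defs
  imports "HOL-Analysis.Analysis"
begin

section \<open>The golden L\<close>

definition golden_ratio :: real ("\<phi>") where
  "\<phi> = (1 + sqrt 5) / 2"

definition L_polygon :: "(real^2) set" where
  "L_polygon = {p. 0 \<le> p $ 1 \<and> p $ 1 \<le> \<phi> \<and> 0 \<le> p $ 2 \<and> p $ 2 \<le> 1}
             \<union> {p. 0 \<le> p $ 1 \<and> p $ 1 \<le> 1 \<and> 0 \<le> p $ 2 \<and> p $ 2 \<le> \<phi>}"

inductive side_pairing :: "real^2 \<Rightarrow> real^2 \<Rightarrow> bool" where
  "0 \<le> y \<Longrightarrow> y \<le> 1 \<Longrightarrow> side_pairing (vector [\<phi>, y]) (vector [0, y])"
| "1 \<le> y \<Longrightarrow> y \<le> \<phi> \<Longrightarrow> side_pairing (vector [1, y]) (vector [0, y])"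
| "1 \<le> x \<Longrightarrow> x \<le> \<phi> \<Longrightarrow> side_pairing (vector [x, 1]) (vector [x, 0])"
| "0 \<le> x \<Longrightarrow> x \<le> 1 \<Longrightarrow> side_pairing (vector [x, \<phi>]) (vector [x, 0])"

text \<open>Points of the surface are the equivalence classes of points of the polygon.\<close>

definition surf_pt :: "real^2 \<Rightarrow> (real^2) set" where
  "surf_pt p = {q. equivclp side_pairing p q}"

definition golden_L :: "(real^2) set topology" where
  "golden_L = topology (\<lambda>U. U \<subseteq> surf_pt ` L_polygon \<and>
     openin (top_of_set L_polygon) {p \<in> L_polygon. surf_pt p \<in> U})"

lemma openin_golden_L:
  "openin golden_L U \<longleftrightarrow> U \<subseteq> surf_pt ` L_polygon \<and>
     openin (top_of_set L_polygon) {p \<in> L_polygon. surf_pt p \<in> U}"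
proof -
  let ?O = "\<lambda>U. U \<subseteq> surf_pt ` L_polygon \<and>
     openin (top_of_set L_polygon) {p \<in> L_polygon. surf_pt p \<in> U}"
  have 1: "{p \<in> L_polygon. surf_pt p \<in> S \<inter> T} =
      {p \<in> L_polygon. surf_pt p \<in> S} \<inter> {p \<in> L_polygon. surf_pt p \<in> T}" for S T
    by auto
  have 2: "{p \<in> L_polygon. surf_pt p \<in> \<Union>K} =
      \<Union> ((\<lambda>S. {p \<in> L_polygon. surf_pt p \<in> S}) ` K)" for K
    by auto
  have "?O (S \<inter> T)" if "?O S" "?O T" for S T
    using that unfolding 1 by (auto intro: openin_Int)
  moreover have "?O (\<Union>K)" if "\<forall>S\<in>K. ?O S" for K
    using that unfolding 2 by (auto intro!: openin_Union)
  ultimately have "istopology ?O"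
    unfolding istopology_def by blast
  then show ?thesis
    unfolding golden_L_def by simp
qed

lemma topspace_golden_L: "topspace golden_L = surf_pt ` L_polygon"
proof
  show "topspace golden_L \<subseteq> surf_pt ` L_polygon"
    using openin_golden_L openin_topspace by blast
  have "{p \<in> L_polygon. surf_pt p \<in> surf_pt ` L_polygon} = L_polygon" by auto
  then have "openin golden_L (surf_pt ` L_polygon)"
    by (simp add: openin_golden_L)
  then show "surf_pt ` L_polygon \<subseteq> topspace golden_L"
    by (rule openin_subset)
qed

lemma quotient_map_surf_pt: "quotient_map (top_of_set L_polygon) golden_L surf_pt"
  unfolding quotient_map_def topspace_golden_L openin_golden_L by simp

text \<open>The eight points of the polygon boundary at which paired sides end form a single class
  (lemma \<open>vertices_in_singularity\<close>), which is the cone point of angle \<open>6\<pi>\<close>.\<close>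

definition singularity :: "(real^2) set" where
  "singularity = surf_pt (vector [0, 0])"

lemma vertices_in_singularity:
  "{vector [0, 0], vector [1, 0], vector [\<phi>, 0], vector [\<phi>, 1], vector [1, 1],
    vector [1, \<phi>], vector [0, \<phi>], vector [0, 1]} \<subseteq> singularity"
proof -
  have phi: "1 \<le> \<phi>"
    unfolding golden_ratio_def by (simp add: real_le_rsqrt)
  note T = equivclp_trans[of side_pairing]
  note I = r_into_equivclp[of side_pairing]
  note S = equivclp_sym[of side_pairing]
  have a: "equivclp side_pairing (vector [\<phi>, 0]) (vector [0, 0])"
    by (rule I, rule side_pairing.intros(1)) auto
  have b: "equivclp side_pairing (vector [\<phi>, 1]) (vector [0, 1])"
    by (rule I, rule side_pairing.intros(1)) auto
  have c: "equivclp side_pairing (vector [1, 1]) (vector [0, 1])"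
    by (rule I, rule side_pairing.intros(2)) (auto simp: phi)
  have d: "equivclp side_pairing (vector [1, \<phi>]) (vector [0, \<phi>])"
    by (rule I, rule side_pairing.intros(2)) (auto simp: phi)
  have e: "equivclp side_pairing (vector [1, 1]) (vector [1, 0])"
    by (rule I, rule side_pairing.intros(3)) (auto simp: phi)
  have f: "equivclp side_pairing (vector [\<phi>, 1]) (vector [\<phi>, 0])"
    by (rule I, rule side_pairing.intros(3)) (auto simp: phi)
  have g: "equivclp side_pairing (vector [0, \<phi>]) (vector [0, 0])"
    by (rule I, rule side_pairing.intros(4)) auto
  have h: "equivclp side_pairing (vector [1, \<phi>]) (vector [1, 0])"
    by (rule I, rule side_pairing.intros(4)) auto
  show ?thesis
    unfolding singularity_def surf_pt_def
    using a b c d e f g h by (auto; metis S T)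
qed

section \<open>Straight trajectories, saddle connections and cylinders\<close>

text \<open>The curve \<open>\<gamma>\<close> leaves (resp. arrives at) its point at time \<open>t\<close> along a segment of constant
  velocity \<open>v\<close> inside the polygon. The representative of the point \<open>\<gamma> t\<close> from which the curve
  leaves need not be the one at which it arrives: this is how trajectories cross glued sides.
  At a nonsingular point each direction has exactly one germ of a segment, so there
  \<open>leaves v \<gamma> t\<close> and \<open>arrives v \<gamma> t\<close> together say that \<open>\<gamma>\<close> is straight near \<open>t\<close> in the
  translation structure.\<close>

definition leaves :: "real^2 \<Rightarrow> (real \<Rightarrow> (real^2) set) \<Rightarrow> real \<Rightarrow> bool" where
  "leaves v \<gamma> t \<longleftrightarrow> (\<exists>p. \<exists>\<epsilon>>0. \<forall>s. 0 \<le> s \<and> s \<le> \<epsilon> \<longrightarrow>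
     p + s *\<^sub>R v \<in> L_polygon \<and> \<gamma> (t + s) = surf_pt (p + s *\<^sub>R v))"

definition arrives :: "real^2 \<Rightarrow> (real \<Rightarrow> (real^2) set) \<Rightarrow> real \<Rightarrow> bool" where
  "arrives v \<gamma> t \<longleftrightarrow> (\<exists>p. \<exists>\<epsilon>>0. \<forall>s. 0 \<le> s \<and> s \<le> \<epsilon> \<longrightarrow>
     p - s *\<^sub>R v \<in> L_polygon \<and> \<gamma> (t - s) = surf_pt (p - s *\<^sub>R v))"

text \<open>Trajectories have constant velocity and are run through in unit time, so that the
  velocity \<open>v\<close> is the holonomy vector.\<close>

definition saddle_connection :: "real^2 \<Rightarrow> (real \<Rightarrow> (real^2) set) \<Rightarrow> bool" where
  "saddle_connection v \<gamma> \<longleftrightarrow> v \<noteq> 0 \<and>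
     (\<forall>t. 0 \<le> t \<and> t < 1 \<longrightarrow> leaves v \<gamma> t) \<and> (\<forall>t. 0 < t \<and> t \<le> 1 \<longrightarrow> arrives v \<gamma> t) \<and>
     \<gamma> 0 = singularity \<and> \<gamma> 1 = singularity \<and>
     (\<forall>t. 0 < t \<and> t < 1 \<longrightarrow> \<gamma> t \<noteq> singularity)"

definition periodic_trajectory :: "real^2 \<Rightarrow> (real \<Rightarrow> (real^2) set) \<Rightarrow> bool" where
  "periodic_trajectory v \<gamma> \<longleftrightarrow> v \<noteq> 0 \<and>
     (\<forall>t. leaves v \<gamma> t \<and> arrives v \<gamma> t \<and> \<gamma> t \<noteq> singularity) \<and>
     (\<forall>t. \<gamma> (t + 1) = \<gamma> t)"

definition primitive_trajectory :: "real^2 \<Rightarrow> (real \<Rightarrow> (real^2) set) \<Rightarrow> bool" where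
  "primitive_trajectory v \<gamma> \<longleftrightarrow> periodic_trajectory v \<gamma> \<and>
     \<not> (\<exists>s. 0 < s \<and> s < 1 \<and> (\<forall>t. \<gamma> (t + s) = \<gamma> t))"

definition same_direction :: "real^2 \<Rightarrow> real^2 \<Rightarrow> bool" where
  "same_direction v w \<longleftrightarrow> (\<exists>c>0. w = c *\<^sub>R v)"

definition periodic_points :: "real^2 \<Rightarrow> (real^2) set set" where
  "periodic_points v =
     \<Union> {range \<gamma> | \<gamma> w. primitive_trajectory w \<gamma> \<and> same_direction v w}"

text \<open>\<open>C\<close> is a cylinder with cylinder vector \<open>v\<close>. A maximal family of parallel periodic
  trajectories is encoded by the set of points it sweeps out, that is, by a connected component
  of the set of all points on periodic trajectories in the given direction. All primitive
  trajectories in \<open>C\<close> in the direction of \<open>v\<close> have the same holonomy vector.\<close>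

definition cylinder :: "(real^2) set set \<Rightarrow> real^2 \<Rightarrow> bool" where
  "cylinder C v \<longleftrightarrow>
     C \<in> connected_components_of (subtopology golden_L (periodic_points v)) \<and>
     (\<exists>\<gamma>. primitive_trajectory v \<gamma> \<and> range \<gamma> \<subseteq> C)"

text \<open>In each periodic direction there are two cylinders and two lengths of saddle connections;
  ``short'' and ``long'' refer to the smaller and the larger length in the same direction.\<close>

definition short_cylinder_vectors :: "(real^2) set" where
  "short_cylinder_vectors =
     {v. \<exists>C. cylinder C v \<and> (\<forall>D w. cylinder D w \<and> same_direction v w \<longrightarrow> norm v \<le> norm w)}"

definition long_saddle_connection_vectors :: "(real^2) set" where
  "long_saddle_connection_vectors =
     {v. \<exists>\<gamma>. saddle_connection v \<gamma> \<and>
        (\<forall>\<delta> w. saddle_connection w \<delta> \<and> same_direction v w \<longrightarrow> norm w \<le> norm v)}"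

definition positive_cone :: "(real^2) set" where
  "positive_cone = {v. v $ 1 > 0 \<and> v $ 2 \<ge> 0}"

section \<open>Words in the matrices \<open>\<sigma>\<^sub>0, \<dots>, \<sigma>\<^sub>3\<close>\<close>

definition \<sigma>\<^sub>0 :: "real^2^2" where "\<sigma>\<^sub>0 = vector [vector [1, \<phi>], vector [0, 1]]"
definition \<sigma>\<^sub>1 :: "real^2^2" where "\<sigma>\<^sub>1 = vector [vector [\<phi>, \<phi>], vector [1, \<phi>]]"
definition \<sigma>\<^sub>2 :: "real^2^2" where "\<sigma>\<^sub>2 = vector [vector [\<phi>, 1], vector [\<phi>, \<phi>]]"
definition \<sigma>\<^sub>3 :: "real^2^2" where "\<sigma>\<^sub>3 = vector [vector [1, 0], vector [\<phi>, 1]]"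

definition alphabet :: "(real^2^2) set" where
  "alphabet = {\<sigma>\<^sub>0, \<sigma>\<^sub>1, \<sigma>\<^sub>2, \<sigma>\<^sub>3}"

text \<open>The first letter of the word is the rightmost factor of the product.\<close>

fun word_matrix :: "(real^2^2) list \<Rightarrow> real^2^2" where
  "word_matrix [] = mat 1"
| "word_matrix (\<sigma> # \<sigma>s) = word_matrix \<sigma>s ** \<sigma>"

definition word_vector :: "(real^2^2) list \<Rightarrow> real^2" where
  "word_vector \<sigma>s = word_matrix \<sigma>s *v vector [1, 0]"

end

theory Submission
  imports Defs
begin

text \<open>The Veech group of the golden L contains a reflection, the exchange of the coordinates and the
  horizontal multitwist \<open>\<sigma>\<^sub>0\<close>; each is realised by a piecewise affine self-map of the polygon that
  respects the gluings. They generate all \<open>\<sigma>\<^sub>i\<close> and their inverses, so both sets of vectors are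
  invariant under these matrices. The \<open>\<sigma>\<^sub>i\<close> map the positive cone onto the four sectors of a partition
  of it, which gives uniqueness of words. Conversely, applying the inverse of the matrix whose sector
  contains a given vector decreases the sum of the coordinates by a fixed amount, because the
  positive coordinates of holonomy vectors are bounded below; so the process ends on the horizontal
  axis, where the only vector of either set is \<open>(1, 0)\<close>.\<close>

section \<open>Points of the golden L\<close>

text \<open>Short cylinder vectors and long saddle connection vectors are never compared directly:
  the descent is stated for an arbitrary invariant set, and each of the two sets is shown to equal
  the set of word vectors. Two obstacles shape the rest. A trajectory consists of classes of points,
  and the representative it leaves from may differ from the one it arrives at, so it has no
  coordinates of its own. But a gluing changes a coordinate only between the values 0, 1 and \<phi>.
  Away from these a coordinate is well defined on the surface and changes linearly, which yields the
  lower bounds 1 for periodic trajectories and \<phi> - 1 for saddle connections. Moreover, an image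
  of a periodic trajectory is clearly periodic, whereas an image of a primitive one is clearly
  primitive only if the surface map is injective. Hence the shortest cylinder vectors are replaced
  by the shortest holonomy vectors of all periodic trajectories, and extremality is expressed
  through positive multiples instead of norms, so that it is compatible with linear maps.\<close>

lemma phi_sq: "\<phi> * \<phi> = \<phi> + 1"
  unfolding golden_ratio_def by (simp add: field_simps)

lemma phi_bounds: "1.6 < \<phi>" "\<phi> < 1.7"
proof -
  have "2.2 < sqrt (5::real)" "sqrt (5::real) < 2.4"
    by (rule real_less_rsqrt real_less_lsqrt; simp add: power2_eq_square)+
  then show "1.6 < \<phi>" "\<phi> < 1.7" by (simp_all add: golden_ratio_def)
qed

lemma phi_between_1_2: "1 < \<phi>" "\<phi> < 2"
  using phi_bounds by simp_all

lemma vector2_eta: "(v :: 'a::zero^2) = vector [v $ 1, v $ 2]"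
  by (simp add: vec_eq_iff forall_2)

lemma vector2_eq_iff: "(v :: 'a^2) = w \<longleftrightarrow> v $ 1 = w $ 1 \<and> v $ 2 = w $ 2"
  by (simp add: vec_eq_iff forall_2)

lemma surf_pt_eq_iff: "surf_pt p = surf_pt q \<longleftrightarrow> equivclp side_pairing p q"
  unfolding surf_pt_def
  by (auto intro: equivclp_trans equivclp_sym)

lemma mem_surf_pt: "p \<in> surf_pt p"
  by (simp add: surf_pt_def)

lemma side_pairing_L: "side_pairing p q \<Longrightarrow> p \<in> L_polygon \<and> q \<in> L_polygon"
  using phi_bounds by (auto elim!: side_pairing.cases simp: L_polygon_def)

lemma equivclp_invariant:
  assumes "equivclp R p q" and "\<And>p q. R p q \<Longrightarrow> P p \<longleftrightarrow> P q"
  shows "P p \<longleftrightarrow> P q"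
  using assms(1) by (induction rule: equivclp_induct) (auto dest: assms(2))

lemma surf_pt_invariant:
  assumes "surf_pt p = surf_pt q" and "\<And>p q. side_pairing p q \<Longrightarrow> P p \<longleftrightarrow> P q"
  shows "P p \<longleftrightarrow> P q"
  by (rule equivclp_invariant[OF assms(1)[unfolded surf_pt_eq_iff] assms(2)])

lemma equivclp_L:
  "surf_pt p = surf_pt q \<Longrightarrow> p \<in> L_polygon \<longleftrightarrow> q \<in> L_polygon"
  by (rule surf_pt_invariant) (use side_pairing_L in blast)+

text \<open>These are the coordinates at which paired sides end. Each gluing fixes one coordinate
  and moves the other between two of these values, so a coordinate outside \<open>grid\<close> is
  determined by the class of the point.\<close>

definition grid :: "real set" where
  "grid = {0, 1, \<phi>}"

lemma grid_simps: "0 \<in> grid" "1 \<in> grid" "\<phi> \<in> grid"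
  by (simp_all add: grid_def)

lemma surf_pt_coord_1:
  assumes "surf_pt p = surf_pt q"
  shows "p $ 1 = q $ 1 \<or> p $ 1 \<in> grid \<and> q $ 1 \<in> grid"
proof -
  have "(p $ 1 = x \<and> x \<notin> grid) \<longleftrightarrow> (q $ 1 = x \<and> x \<notin> grid)" for x
    using assms by (rule surf_pt_invariant) (auto elim!: side_pairing.cases simp: grid_def)
  then show ?thesis by metis
qed

lemma surf_pt_coord_2:
  assumes "surf_pt p = surf_pt q"
  shows "p $ 2 = q $ 2 \<or> p $ 2 \<in> grid \<and> q $ 2 \<in> grid"
proof -
  have "(p $ 2 = x \<and> x \<notin> grid) \<longleftrightarrow> (q $ 2 = x \<and> x \<notin> grid)" for x
    using assms by (rule surf_pt_invariant) (auto elim!: side_pairing.cases simp: grid_def)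
  then show ?thesis by metis
qed

definition vertex :: "real^2 \<Rightarrow> bool" where
  "vertex p \<longleftrightarrow> p $ 1 \<in> grid \<and> p $ 2 \<in> grid"

lemma surf_pt_vertex: "surf_pt p = surf_pt q \<Longrightarrow> vertex p \<longleftrightarrow> vertex q"
  by (rule surf_pt_invariant) (auto elim!: side_pairing.cases simp: grid_def vertex_def)

lemma surf_pt_eq_singularity:
  assumes "p \<in> L_polygon"
  shows "surf_pt p = singularity \<longleftrightarrow> vertex p"
proof
  assume "surf_pt p = singularity"
  then show "vertex p"
    using surf_pt_vertex[of p "vector [0, 0]"] by (simp add: singularity_def vertex_def grid_def)
next
  assume "vertex p"
  \<comment> \<open>Of the nine points with both coordinates in \<open>grid\<close>, only (\<phi>,
    \<phi>) lies outside the polygon.\<close>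
  then have "p $ 1 = x \<and> p $ 2 = y \<Longrightarrow> (x, y) \<noteq> (\<phi>, \<phi>)" for x y
    using assms phi_bounds by (auto simp: L_polygon_def)
  with \<open>vertex p\<close> have "p \<in> {vector [0, 0], vector [1, 0], vector [\<phi>, 0], vector [\<phi>, 1], vector [1, 1],
    vector [1, \<phi>], vector [0, \<phi>], vector [0, 1]}"
    unfolding vertex_def grid_def insert_iff empty_iff vector2_eq_iff vector_2 by metis
  then have "p \<in> singularity"
    using vertices_in_singularity by blast
  then show "surf_pt p = singularity"
    unfolding singularity_def surf_pt_eq_iff using equivclp_sym[of side_pairing]
    by (auto simp: surf_pt_def)
qed

text \<open>Distinguishes the two vertical gluings: an interior point of the side at \<phi> is
  identified with a point at 0, never with one at 1. This decides where a trajectory that runs into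
  that side continues.\<close>

lemma surf_pt_long_side:
  assumes "surf_pt p = surf_pt q"
  shows "vertex p \<or> p $ 1 \<in> {0, \<phi>} \<and> 0 < p $ 2 \<and> p $ 2 < 1 \<longleftrightarrow>
     vertex q \<or> q $ 1 \<in> {0, \<phi>} \<and> 0 < q $ 2 \<and> q $ 2 < 1"
  using assms
proof (rule surf_pt_invariant)
  fix p q assume "side_pairing p q"
  then show "vertex p \<or> p $ 1 \<in> {0, \<phi>} \<and> 0 < p $ 2 \<and> p $ 2 < 1 \<longleftrightarrow>
     vertex q \<or> q $ 1 \<in> {0, \<phi>} \<and> 0 < q $ 2 \<and> q $ 2 < 1"
    by cases (use phi_bounds in \<open>simp_all add: vertex_def grid_simps\<close>)
qed

text \<open>Continuous induction, by taking a supremum. It fits the local description of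
  trajectories: \<open>leaves\<close> supplies \<open>step\<close>, and \<open>arrives\<close>
  supplies \<open>limit\<close>.\<close>

lemma real_interval_induct [consumes 2, case_names base step limit]:
  fixes P :: "real \<Rightarrow> bool"
  assumes t: "a \<le> t" "t \<le> b"
    and base: "P a"
    and step: "\<And>t. a \<le> t \<Longrightarrow> t < b \<Longrightarrow> P t \<Longrightarrow> \<exists>\<epsilon>>0. \<forall>s. 0 \<le> s \<and> s \<le> \<epsilon> \<and> t + s \<le> b \<longrightarrow> P (t + s)"
    and limit: "\<And>t. a < t \<Longrightarrow> t \<le> b \<Longrightarrow> (\<And>s. a \<le> s \<Longrightarrow> s < t \<Longrightarrow> P s) \<Longrightarrow> P t"
  shows "P t"
proof -
  define S where "S = {t. a \<le> t \<and> t \<le> b \<and> (\<forall>s. a \<le> s \<and> s \<le> t \<longrightarrow> P s)}"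
  define m where "m = Sup S"
  have aS: "a \<in> S" using base t by (auto simp: S_def)
  have bdd: "bdd_above S" by (auto simp: S_def bdd_above_def)
  have am: "a \<le> m" unfolding m_def using aS bdd by (rule cSup_upper)
  have mb: "m \<le> b" unfolding m_def using aS by (intro cSup_least) (auto simp: S_def)
  have below: "P s" if "a \<le> s" "s < m" for s
  proof -
    have "S \<noteq> {}" using aS by auto
    with that(2) bdd obtain u where "u \<in> S" "s < u"
      unfolding m_def by (auto simp: less_cSup_iff)
    then show ?thesis using that by (auto simp: S_def)
  qed
  have Pm: "P m"
    using am mb below base limit[of m] by (cases "a = m") auto
  have mS: "m \<in> S"
    using am mb below Pm unfolding S_def by (auto simp: le_less)
  have "m = b"
  proof (rule ccontr)
    assume "m \<noteq> b"
    with step[OF am _ Pm] mb obtain e where e: "e > 0" "\<And>s. 0 \<le> s \<Longrightarrow> s \<le> e \<Longrightarrow> m + s \<le> b \<Longrightarrow> P (m + s)"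
      by auto
    define u where "u = min (m + e) b"
    have "P s" if "a \<le> s" "s \<le> u" for s
      using that e(2)[of "s - m"] below[of s] unfolding u_def by (cases "s < m") auto
    then have "u \<in> S"
      using am mb e(1) by (auto simp: S_def u_def)
    then have "u \<le> m" unfolding m_def using bdd by (intro cSup_upper)
    with e(1) \<open>m \<noteq> b\<close> mb show False by (auto simp: u_def)
  qed
  with mS t show ?thesis by (auto simp: S_def)
qed

section \<open>Coordinates along a trajectory\<close>

lemma leaves_obtain:
  assumes "leaves v \<gamma> t"
  obtains p \<epsilon> where "\<epsilon> > 0" "\<And>s. 0 \<le> s \<Longrightarrow> s \<le> \<epsilon> \<Longrightarrow> p + s *\<^sub>R v \<in> L_polygon"
    "\<And>s. 0 \<le> s \<Longrightarrow> s \<le> \<epsilon> \<Longrightarrow> \<gamma> (t + s) = surf_pt (p + s *\<^sub>R v)"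
    "p \<in> L_polygon" "\<gamma> t = surf_pt p"
proof -
  obtain p \<epsilon> where *: "\<epsilon> > 0" "\<forall>s. 0 \<le> s \<and> s \<le> \<epsilon> \<longrightarrow>
     p + s *\<^sub>R v \<in> L_polygon \<and> \<gamma> (t + s) = surf_pt (p + s *\<^sub>R v)"
    using assms by (auto simp: leaves_def)
  show thesis
    by (rule that[of \<epsilon> p]) (use * in \<open>auto dest: spec[of _ 0]\<close>)
qed

lemma arrives_obtain:
  assumes "arrives v \<gamma> t"
  obtains p \<epsilon> where "\<epsilon> > 0" "\<And>s. 0 \<le> s \<Longrightarrow> s \<le> \<epsilon> \<Longrightarrow> p - s *\<^sub>R v \<in> L_polygon"
    "\<And>s. 0 \<le> s \<Longrightarrow> s \<le> \<epsilon> \<Longrightarrow> \<gamma> (t - s) = surf_pt (p - s *\<^sub>R v)"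
    "p \<in> L_polygon" "\<gamma> t = surf_pt p"
proof -
  obtain p \<epsilon> where *: "\<epsilon> > 0" "\<forall>s. 0 \<le> s \<and> s \<le> \<epsilon> \<longrightarrow>
     p - s *\<^sub>R v \<in> L_polygon \<and> \<gamma> (t - s) = surf_pt (p - s *\<^sub>R v)"
    using assms by (auto simp: arrives_def)
  show thesis
    by (rule that[of \<epsilon> p]) (use * in \<open>auto dest: spec[of _ 0]\<close>)
qed

lemma arrives_iff_leaves: "arrives v \<gamma> t \<longleftrightarrow> leaves (- v) (\<lambda>s. \<gamma> (- s)) (- t)"
  by (simp add: arrives_def leaves_def)

text \<open>The first coordinate of the points of a trajectory can only jump at values in the grid.\<close>

lemma coord_1_linear:
  assumes v: "v $ 1 > 0" and ab: "a \<le> t" "t \<le> b"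
    and p: "\<epsilon> > 0" "\<And>s. 0 \<le> s \<Longrightarrow> s \<le> \<epsilon> \<Longrightarrow> \<gamma> (a + s) = surf_pt (p + s *\<^sub>R v)"
    and lv: "\<And>t. a < t \<Longrightarrow> t < b \<Longrightarrow> leaves v \<gamma> t"
    and ar: "\<And>t. a < t \<Longrightarrow> t \<le> b \<Longrightarrow> arrives v \<gamma> t"
    and grid: "\<And>x. p $ 1 < x \<Longrightarrow> x < p $ 1 + v $ 1 * (b - a) \<Longrightarrow> x \<notin> grid"
  shows "\<exists>q. \<gamma> t = surf_pt q \<and> q $ 1 = p $ 1 + v $ 1 * (t - a)"
  using ab
proof (induction rule: real_interval_induct)
  case base
  show ?case using p(1) p(2)[of 0] by (intro exI[of _ p]) auto
next
  case (step t)
  show ?case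
  \<comment> \<open>At the initial time the coordinate may lie in \<open>grid\<close>, where the
    class does not determine it; there the given germ at \<open>p\<close> is used. At later times
    both representatives agree in this coordinate.\<close>
  proof (cases "t = a")
    case True
    have "\<exists>q. \<gamma> (a + s) = surf_pt q \<and> q $ 1 = p $ 1 + v $ 1 * (a + s - a)"
      if "0 \<le> s" "s \<le> \<epsilon>" for s
      using p(2)[of s] that by (intro exI[of _ "p + s *\<^sub>R v"]) (auto simp: mult.commute)
    with True p(1) show ?thesis by blast
  next
    case False
    with step obtain q where q: "\<gamma> t = surf_pt q" "q $ 1 = p $ 1 + v $ 1 * (t - a)" by auto
    from False step lv have "leaves v \<gamma> t" by auto
    then obtain r e where r: "e > 0" "\<And>s. 0 \<le> s \<Longrightarrow> s \<le> e \<Longrightarrow> \<gamma> (t + s) = surf_pt (r + s *\<^sub>R v)"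
      "\<gamma> t = surf_pt r" by (rule leaves_obtain) blast
    have "q $ 1 \<notin> grid"
      using False step v by (intro grid) (auto simp: q)
    with surf_pt_coord_1[of q r] q r have "r $ 1 = q $ 1" by auto
    then have "\<exists>q. \<gamma> (t + s) = surf_pt q \<and> q $ 1 = p $ 1 + v $ 1 * (t + s - a)"
      if "0 \<le> s" "s \<le> e" for s
      using r(2)[of s] that q(2) by (intro exI[of _ "r + s *\<^sub>R v"]) (auto simp: algebra_simps)
    with r(1) show ?thesis by blast
  qed
next
  case (limit t)
  obtain q e where q: "e > 0" "\<And>s. 0 \<le> s \<Longrightarrow> s \<le> e \<Longrightarrow> \<gamma> (t - s) = surf_pt (q - s *\<^sub>R v)"
      "\<gamma> t = surf_pt q" using ar[OF limit(1,2)] by (rule arrives_obtain) blast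
  \<comment> \<open>Going back at most half way to \<open>a\<close> stays strictly after
    \<open>a\<close>. The coordinate there is outside \<open>grid\<close>, so it pins down the
    arriving germ.\<close>
  define s where "s = min e ((t - a) / 2)"
  have s: "0 < s" "s \<le> e" "a < t - s" using q(1) limit(1) by (auto simp: s_def min_def field_simps)
  then obtain r where r: "\<gamma> (t - s) = surf_pt r" "r $ 1 = p $ 1 + v $ 1 * (t - s - a)"
    using limit(3)[of "t - s"] by auto
  have "r $ 1 \<notin> grid"
    using s limit v by (intro grid) (auto simp: r)
  with surf_pt_coord_1[of r "q - s *\<^sub>R v"] q(2)[of s] r s have "(q - s *\<^sub>R v) $ 1 = r $ 1" by auto
  then have "q $ 1 = p $ 1 + v $ 1 * (t - a)" by (simp add: r algebra_simps)
  with q(3) show ?case by blast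
qed

text \<open>Whether the second coordinate is in \<open>grid\<close> depends only on the class, and a
  horizontal germ does not change that coordinate. Thus a horizontal trajectory that starts at the
  singularity is at a vertex whenever its first coordinate is in \<open>grid\<close>.\<close>

lemma horizontal_stays_in_grid:
  assumes v: "v $ 2 = 0" and ab: "a \<le> t" "t \<le> b" and pa: "\<gamma> a = surf_pt p" "p $ 2 \<in> grid"
    and lv: "\<And>t. a \<le> t \<Longrightarrow> t < b \<Longrightarrow> leaves v \<gamma> t"
    and ar: "\<And>t. a < t \<Longrightarrow> t \<le> b \<Longrightarrow> arrives v \<gamma> t"
    and q: "\<gamma> t = surf_pt q"
  shows "q $ 2 \<in> grid"
proof -
  have "\<exists>q. \<gamma> t = surf_pt q \<and> q $ 2 \<in> grid"
    using ab
  proof (induction rule: real_interval_induct)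
    case base
    show ?case using pa by blast
  next
    case (step t)
    then obtain q where q: "\<gamma> t = surf_pt q" "q $ 2 \<in> grid" by auto
    from step lv have "leaves v \<gamma> t" by auto
    then obtain r e where r: "e > 0" "\<And>s. 0 \<le> s \<Longrightarrow> s \<le> e \<Longrightarrow> \<gamma> (t + s) = surf_pt (r + s *\<^sub>R v)"
      "\<gamma> t = surf_pt r" by (rule leaves_obtain) blast
    have "r $ 2 \<in> grid" using surf_pt_coord_2[of q r] q r by auto
    then have "\<exists>q. \<gamma> (t + s) = surf_pt q \<and> q $ 2 \<in> grid" if "0 \<le> s" "s \<le> e" for s
      using r(2)[of s] that v by (intro exI[of _ "r + s *\<^sub>R v"]) auto
    with r(1) show ?case by blast
  next
    case (limit t)
    obtain q e where q: "e > 0" "\<And>s. 0 \<le> s \<Longrightarrow> s \<le> e \<Longrightarrow> \<gamma> (t - s) = surf_pt (q - s *\<^sub>R v)"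
      "\<gamma> t = surf_pt q" using ar[OF limit(1,2)] by (rule arrives_obtain) blast
    define s where "s = min e (t - a)"
    have s: "0 < s" "s \<le> e" "a \<le> t - s" using q(1) limit(1) by (auto simp: s_def)
    then obtain r where r: "\<gamma> (t - s) = surf_pt r" "r $ 2 \<in> grid"
      using limit(3)[of "t - s"] by auto
    with surf_pt_coord_2[of r "q - s *\<^sub>R v"] q(2)[of s] s v have "q $ 2 \<in> grid" by auto
    with q(3) show ?case by blast
  qed
  with surf_pt_coord_2 q show ?thesis by metis
qed

section \<open>Lower bounds for holonomy vectors\<close>

lemma leaving_coord_1_less:
  assumes "v $ 1 > 0" "\<epsilon> > 0" "\<And>s. 0 \<le> s \<Longrightarrow> s \<le> \<epsilon> \<Longrightarrow> p + s *\<^sub>R v \<in> L_polygon"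
  shows "0 \<le> p $ 1" "p $ 1 < \<phi>"
proof -
  show "0 \<le> p $ 1" using assms(2) assms(3)[of 0] by (auto simp: L_polygon_def)
  have "p $ 1 + \<epsilon> * v $ 1 \<le> \<phi>"
    using assms(2) assms(3)[of \<epsilon>] phi_bounds by (auto simp: L_polygon_def)
  moreover have "\<epsilon> * v $ 1 > 0" using assms by simp
  ultimately show "p $ 1 < \<phi>" by simp
qed

text \<open>A vertex from which one can move to the right has first coordinate 0 or 1, and the next
  value in \<open>grid\<close> is at distance 1 or \<phi> - 1. A shorter horizontal displacement
  would end strictly between two such values, not at a vertex.\<close>

lemma saddle_connection_coord_1_ge:
  assumes "saddle_connection v \<gamma>" "v $ 1 > 0"
  shows "v $ 1 \<ge> \<phi> - 1"
proof (rule ccontr)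
  assume less: "\<not> v $ 1 \<ge> \<phi> - 1"
  have sc: "\<And>t. 0 \<le> t \<Longrightarrow> t < 1 \<Longrightarrow> leaves v \<gamma> t" "\<And>t. 0 < t \<Longrightarrow> t \<le> 1 \<Longrightarrow> arrives v \<gamma> t"
    "\<gamma> 0 = singularity" "\<gamma> 1 = singularity"
    using assms(1) by (auto simp: saddle_connection_def)
  obtain p e where p: "e > 0" "\<And>s. 0 \<le> s \<Longrightarrow> s \<le> e \<Longrightarrow> p + s *\<^sub>R v \<in> L_polygon"
    "\<And>s. 0 \<le> s \<Longrightarrow> s \<le> e \<Longrightarrow> \<gamma> (0 + s) = surf_pt (p + s *\<^sub>R v)" "p \<in> L_polygon" "\<gamma> 0 = surf_pt p"
    using sc(1)[of 0] leaves_obtain by (metis order_refl zero_less_one)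
  have "vertex p" using p(4,5) sc(3) surf_pt_eq_singularity by auto
  then have p1: "p $ 1 = 0 \<or> p $ 1 = 1"
    using leaving_coord_1_less[OF assms(2) p(1,2)] by (auto simp: vertex_def grid_def)
  have "\<exists>q. \<gamma> 1 = surf_pt q \<and> q $ 1 = p $ 1 + v $ 1 * (1 - 0)"
    by (rule coord_1_linear[where a = 0 and b = 1, OF assms(2) _ _ p(1) p(3)])
      (use sc p1 less phi_bounds in \<open>auto simp: grid_def\<close>)
  then obtain q where q: "\<gamma> 1 = surf_pt q" "q $ 1 = p $ 1 + v $ 1" by auto
  have "vertex q"
    using q(1) sc(4) surf_pt_vertex[of q "vector [0, 0]"]
    by (simp add: singularity_def vertex_def grid_def)
  then show False using q(2) p1 less assms(2) phi_bounds by (auto simp: vertex_def grid_def)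
qed

lemma horizontal_saddle_connection_le:
  assumes "saddle_connection v \<gamma>" "v $ 1 > 0" "v $ 2 = 0"
  shows "v $ 1 \<le> 1"
proof (rule ccontr)
  assume less: "\<not> v $ 1 \<le> 1"
  have sc: "\<And>t. 0 \<le> t \<Longrightarrow> t < 1 \<Longrightarrow> leaves v \<gamma> t" "\<And>t. 0 < t \<Longrightarrow> t \<le> 1 \<Longrightarrow> arrives v \<gamma> t"
    "\<gamma> 0 = singularity" "\<And>t. 0 < t \<Longrightarrow> t < 1 \<Longrightarrow> \<gamma> t \<noteq> singularity"
    using assms(1) by (auto simp: saddle_connection_def)
  obtain p e where p: "e > 0" "\<And>s. 0 \<le> s \<Longrightarrow> s \<le> e \<Longrightarrow> p + s *\<^sub>R v \<in> L_polygon"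
    "\<And>s. 0 \<le> s \<Longrightarrow> s \<le> e \<Longrightarrow> \<gamma> (0 + s) = surf_pt (p + s *\<^sub>R v)" "p \<in> L_polygon" "\<gamma> 0 = surf_pt p"
    using sc(1)[of 0] leaves_obtain by (metis order_refl zero_less_one)
  have vp: "vertex p" using p(4,5) sc(3) surf_pt_eq_singularity by auto
  then have p1: "p $ 1 = 0 \<or> p $ 1 = 1"
    using leaving_coord_1_less[OF assms(2) p(1,2)] by (auto simp: vertex_def grid_def)
  define g where "g = (if p $ 1 = 0 then 1 else \<phi>)"
  \<comment> \<open>The time at which the first coordinate reaches the next grid value
    \<open>g\<close>. The gap is at most 1, so \<open>b < 1\<close> and the singularity would be hit
    too early.\<close>
  define b where "b = (g - p $ 1) / v $ 1"
  have b: "0 < b" "b < 1" and vb: "p $ 1 + v $ 1 * b = g"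
    using p1 less assms(2) phi_bounds by (auto simp: b_def g_def)
  have "\<exists>q. \<gamma> b = surf_pt q \<and> q $ 1 = p $ 1 + v $ 1 * (b - 0)"
    by (rule coord_1_linear[where a = 0 and b = b, OF assms(2) _ _ p(1) p(3)])
      (use b vb sc p1 phi_bounds in \<open>auto simp: grid_def g_def split: if_splits\<close>)
  then obtain q where q: "\<gamma> b = surf_pt q" "q $ 1 = g" using vb by auto
  have "q $ 2 \<in> grid"
    by (rule horizontal_stays_in_grid[where a = 0 and b = b, OF assms(3) _ _ p(5) _ _ _ q(1)])
      (use b sc vp in \<open>auto simp: vertex_def\<close>)
  then have "vertex q" using q(2) by (auto simp: vertex_def g_def grid_simps)
  moreover have "q \<in> L_polygon"
    using arrives_obtain[OF sc(2)[of b]] b q(1) equivclp_L by (metis less_eq_real_def)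
  ultimately show False using sc(4)[of b] b q(1) surf_pt_eq_singularity by auto
qed

text \<open>Starting at 0 rather than at 1 improves the free distance to the next grid value from
  \<phi> - 1 to 1. Moving right, the trajectory meets a grid value and leaves it from 0 or from 1;
  in the latter case it runs on to \<phi>, from where the long side leads to 0.\<close>

lemma periodic_trajectory_crosses_left_side:
  assumes "periodic_trajectory v \<gamma>" "v $ 1 > 0"
  obtains a p \<epsilon> where "\<epsilon> > 0" "\<And>s. 0 \<le> s \<Longrightarrow> s \<le> \<epsilon> \<Longrightarrow> \<gamma> (a + s) = surf_pt (p + s *\<^sub>R v)"
    "p $ 1 = 0"
proof -
  have pt: "\<And>t. leaves v \<gamma> t" "\<And>t. arrives v \<gamma> t" "\<And>t. \<gamma> t \<noteq> singularity"
    using assms(1) by (auto simp: periodic_trajectory_def)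
  have next_grid: "\<exists>b q. \<gamma> b = surf_pt q \<and> q $ 1 = g"
    if "e > 0" "\<And>s. 0 \<le> s \<Longrightarrow> s \<le> e \<Longrightarrow> \<gamma> (a + s) = surf_pt (p + s *\<^sub>R v)" "p $ 1 < g"
      "\<And>x. p $ 1 < x \<Longrightarrow> x < g \<Longrightarrow> x \<notin> grid" for a p e g
  proof -
    define b where "b = a + (g - p $ 1) / v $ 1"
    have b: "a \<le> b" and vb: "p $ 1 + v $ 1 * (b - a) = g"
      using that(3) assms(2) by (auto simp: b_def)
    have "\<exists>q. \<gamma> b = surf_pt q \<and> q $ 1 = p $ 1 + v $ 1 * (b - a)"
      by (rule coord_1_linear[where a = a and b = b, OF assms(2) _ _ that(1,2)])
        (use b vb pt that(4) in auto)
    then show ?thesis using vb by auto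
  qed
  have leave: "\<exists>p e. e > 0 \<and> (\<forall>s. 0 \<le> s \<and> s \<le> e \<longrightarrow> \<gamma> (a + s) = surf_pt (p + s *\<^sub>R v)) \<and>
     p \<in> L_polygon \<and> \<gamma> a = surf_pt p \<and> 0 \<le> p $ 1 \<and> p $ 1 < \<phi>" for a
  proof -
    obtain p e where p: "e > 0" "\<And>s. 0 \<le> s \<Longrightarrow> s \<le> e \<Longrightarrow> p + s *\<^sub>R v \<in> L_polygon"
      "\<And>s. 0 \<le> s \<Longrightarrow> s \<le> e \<Longrightarrow> \<gamma> (a + s) = surf_pt (p + s *\<^sub>R v)" "p \<in> L_polygon" "\<gamma> a = surf_pt p"
      using pt(1) by (rule leaves_obtain) blast
    with leaving_coord_1_less[OF assms(2) p(1,2)] show ?thesis by blast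
  qed
  obtain p e where p: "e > 0" "\<forall>s. 0 \<le> s \<and> s \<le> e \<longrightarrow> \<gamma> (0 + s) = surf_pt (p + s *\<^sub>R v)"
    "0 \<le> p $ 1" "p $ 1 < \<phi>" using leave[of 0] by blast
  define g where "g = (if p $ 1 < 1 then 1 else \<phi>)"
  have "x \<notin> grid" if "p $ 1 < x" "x < g" for x
    using that p(3,4) phi_bounds by (auto simp: g_def grid_def split: if_splits)
  moreover have "p $ 1 < g" using p(4) by (simp add: g_def)
  ultimately obtain b q where q: "\<gamma> b = surf_pt q" "q $ 1 = g"
    using next_grid[of e 0 p g] p(1,2) by blast
  obtain r d where r: "d > 0" "\<forall>s. 0 \<le> s \<and> s \<le> d \<longrightarrow> \<gamma> (b + s) = surf_pt (r + s *\<^sub>R v)"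
    "\<gamma> b = surf_pt r" "0 \<le> r $ 1" "r $ 1 < \<phi>" using leave[of b] by blast
  have "q $ 1 \<in> grid"
    using q(2) by (simp add: g_def grid_simps)
  moreover have "surf_pt q = surf_pt r" using q(1) r(3) by simp
  ultimately have "r $ 1 \<in> grid"
    using surf_pt_coord_1[of q r] by metis
  then consider "r $ 1 = 0" | "r $ 1 = 1" using r(5) by (auto simp: grid_def)
  then show ?thesis
  proof cases
    case 1
    with r(1,2) that[of d b r] show ?thesis by auto
  next
    case 2
    then have "x \<notin> grid" if "r $ 1 < x" "x < \<phi>" for x
      using that by (auto simp: grid_def)
    then obtain c q where q: "\<gamma> c = surf_pt q" "q $ 1 = \<phi>"
      using next_grid[of d b r \<phi>] r(1,2,5) by blast
    obtain u d where u: "d > 0" "\<forall>s. 0 \<le> s \<and> s \<le> d \<longrightarrow> \<gamma> (c + s) = surf_pt (u + s *\<^sub>R v)"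
      "\<gamma> c = surf_pt u" "0 \<le> u $ 1" "u $ 1 < \<phi>" "u \<in> L_polygon" using leave[of c] by blast
    have "q \<in> L_polygon" using equivclp_L[of q u] q(1) u(3,6) by simp
    then have "\<not> vertex q" "\<not> vertex u"
      using pt(3)[of c] q(1) u(3,6) surf_pt_eq_singularity[of q] surf_pt_eq_singularity[of u] by simp_all
    moreover have "0 < q $ 2" "q $ 2 < 1"
      using \<open>\<not> vertex q\<close> \<open>q \<in> L_polygon\<close> q(2) phi_bounds
      by (auto simp: L_polygon_def vertex_def grid_def order_less_le)
    ultimately have "u $ 1 = 0"
      using surf_pt_long_side[of q u] q u(3,5) by auto
    with u(1,2) that[of d c u] show ?thesis by auto
  qed
qed

text \<open>Starting at first coordinate 0, a displacement strictly between 0 and 1 would end at a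
  coordinate outside \<open>grid\<close>, which cannot represent the starting point again.\<close>

lemma periodic_trajectory_coord_1_ge:
  assumes "periodic_trajectory v \<gamma>" "v $ 1 > 0"
  shows "v $ 1 \<ge> 1"
proof (rule ccontr)
  assume less: "\<not> v $ 1 \<ge> 1"
  obtain a p e where p: "e > 0" "\<And>s. 0 \<le> s \<Longrightarrow> s \<le> e \<Longrightarrow> \<gamma> (a + s) = surf_pt (p + s *\<^sub>R v)"
    "p $ 1 = 0" by (rule periodic_trajectory_crosses_left_side[OF assms]) blast
  have "\<exists>q. \<gamma> (a + 1) = surf_pt q \<and> q $ 1 = p $ 1 + v $ 1 * (a + 1 - a)"
    by (rule coord_1_linear[where a = a and b = "a + 1", OF assms(2) _ _ p(1,2)])
      (use assms(1) less p(3) phi_bounds in \<open>auto simp: grid_def periodic_trajectory_def\<close>)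
  then obtain q where "\<gamma> (a + 1) = surf_pt q" "q $ 1 = v $ 1" using p(3) by auto
  moreover have "\<gamma> (a + 1) = surf_pt p"
    using assms(1) p(1) p(2)[of 0] by (auto simp: periodic_trajectory_def)
  ultimately show False
    using surf_pt_coord_1[of p q] p(3) less assms(2) phi_bounds by (auto simp: grid_def)
qed

section \<open>Affine automorphisms\<close>

text \<open>Among points of the segment that converge to \<open>p\<close>, infinitely many lie in
  one of the finitely many sets. This set contains \<open>p\<close> because it is closed, and then a
  whole initial segment because it is convex.\<close>

lemma finite_closed_convex_cover_germ:
  fixes p v :: "'a::real_normed_vector"
  assumes "finite F" and F: "\<And>R. R \<in> F \<Longrightarrow> closed R \<and> convex R"
    and "\<epsilon> > 0" and cover: "\<And>s. 0 \<le> s \<Longrightarrow> s \<le> \<epsilon> \<Longrightarrow> p + s *\<^sub>R v \<in> \<Union>F"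
  obtains R \<delta> where "R \<in> F" "0 < \<delta>" "\<delta> \<le> \<epsilon>" "\<And>s. 0 \<le> s \<Longrightarrow> s \<le> \<delta> \<Longrightarrow> p + s *\<^sub>R v \<in> R"
proof -
  define d where "d n = \<epsilon> * inverse (real (Suc n))" for n
  have d: "0 < d n" "d n \<le> \<epsilon>" for n
    using \<open>\<epsilon> > 0\<close> by (auto simp: d_def field_simps)
  have "\<forall>n. \<exists>R\<in>F. p + d n *\<^sub>R v \<in> R"
    using cover d by (metis Union_iff less_imp_le)
  then obtain f where f: "\<And>n. f n \<in> F" "\<And>n. p + d n *\<^sub>R v \<in> f n" by metis
  have "finite (range f)" using f(1) \<open>finite F\<close> by (auto intro: finite_subset)
  then obtain m where m: "infinite {n. f n = f m}"
    using pigeonhole_infinite[of "UNIV :: nat set" f] by auto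
  have "d \<longlonglongrightarrow> \<epsilon> * 0"
    unfolding d_def by (intro tendsto_mult tendsto_const LIMSEQ_inverse_real_of_nat)
  then have "(\<lambda>n. p + d n *\<^sub>R v) \<longlonglongrightarrow> p + (\<epsilon> * 0) *\<^sub>R v"
    by (intro tendsto_intros)
  then have lim: "(\<lambda>n. p + d n *\<^sub>R v) \<longlonglongrightarrow> p" by simp
  have p: "p \<in> f m"
  proof (rule ccontr)
    assume "p \<notin> f m"
    then have "\<forall>\<^sub>F n in sequentially. p + d n *\<^sub>R v \<in> - f m"
      using F[OF f(1)[of m]] by (intro topological_tendstoD[OF lim]) auto
    then obtain N where "\<And>n. n \<ge> N \<Longrightarrow> p + d n *\<^sub>R v \<notin> f m"
      by (auto simp: eventually_sequentially)
    then have "{n. f n = f m} \<subseteq> {..<N}"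
      using f(2) by (metis (mono_tags, lifting) lessThan_iff mem_Collect_eq not_le subsetI)
    with m show False by (auto dest: finite_subset)
  qed
  show thesis
  proof (rule that[of "f m" "d m"])
    fix s assume s: "0 \<le> s" "s \<le> d m"
    have "(1 - s / d m) *\<^sub>R p + (s / d m) *\<^sub>R (p + d m *\<^sub>R v) \<in> f m"
      using F[OF f(1)[of m]] p f(2)[of m] s d[of m] unfolding convex_alt by auto
    also have "(1 - s / d m) *\<^sub>R p + (s / d m) *\<^sub>R (p + d m *\<^sub>R v) = p + s *\<^sub>R v"
      using d[of m] by (simp add: algebra_simps)
    finally show "p + s *\<^sub>R v \<in> f m" .
  qed (use f d in auto)
qed

text \<open>At most one gluing step, in either direction. The three automorphisms below need no
  longer chains, and unlike the generated equivalence this condition can be decided by arithmetic on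
  coordinates.\<close>

definition glued :: "real^2 \<Rightarrow> real^2 \<Rightarrow> bool" where
  "glued p q \<longleftrightarrow> p = q \<or> side_pairing p q \<or> side_pairing q p"

lemma glued_imp_surf_pt_eq: "glued p q \<Longrightarrow> surf_pt p = surf_pt q"
  unfolding glued_def surf_pt_eq_iff by (metis equivclp_refl equivclp_sym r_into_equivclp)

lemma side_pairing_iff:
  "side_pairing p q \<longleftrightarrow>
     p $ 1 = \<phi> \<and> q $ 1 = 0 \<and> q $ 2 = p $ 2 \<and> 0 \<le> p $ 2 \<and> p $ 2 \<le> 1 \<or>
     p $ 1 = 1 \<and> q $ 1 = 0 \<and> q $ 2 = p $ 2 \<and> 1 \<le> p $ 2 \<and> p $ 2 \<le> \<phi> \<or>
     p $ 2 = 1 \<and> q $ 2 = 0 \<and> q $ 1 = p $ 1 \<and> 1 \<le> p $ 1 \<and> p $ 1 \<le> \<phi> \<or>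
     p $ 2 = \<phi> \<and> q $ 2 = 0 \<and> q $ 1 = p $ 1 \<and> 0 \<le> p $ 1 \<and> p $ 1 \<le> 1"
  by (subst side_pairing.simps) (auto simp: vector2_eq_iff)

text \<open>A self-map of the surface that is \<open>p \<mapsto> A p + b\<close> on each piece \<open>(R, b)\<close>. As the pieces are
  closed and convex, every germ of a segment in the polygon lies in one of them.\<close>

locale affine_automorphism =
  fixes A :: "real^2 \<Rightarrow> real^2" and pieces :: "((real^2) set \<times> (real^2)) set"
  assumes linear: "linear A" and kernel: "A v = 0 \<Longrightarrow> v = 0"
    and finite_pieces: "finite pieces"
    and closed_pieces: "(R, b) \<in> pieces \<Longrightarrow> closed R"
    and convex_pieces: "(R, b) \<in> pieces \<Longrightarrow> convex R"
    and cover: "L_polygon = (\<Union>(R, b)\<in>pieces. R)"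
    and maps: "(R, b) \<in> pieces \<Longrightarrow> p \<in> R \<Longrightarrow> A p + b \<in> L_polygon"
    and vertex_iff: "(R, b) \<in> pieces \<Longrightarrow> p \<in> R \<Longrightarrow> vertex (A p + b) \<longleftrightarrow> vertex p"
    and overlap: "(R, b) \<in> pieces \<Longrightarrow> (R', b') \<in> pieces \<Longrightarrow> p \<in> R \<Longrightarrow> p \<in> R' \<Longrightarrow>
      glued (A p + b) (A p + b')"
    and sides: "side_pairing p q \<Longrightarrow>
      \<exists>(R, b)\<in>pieces. \<exists>(R', b')\<in>pieces. p \<in> R \<and> q \<in> R' \<and> glued (A p + b) (A q + b')"
begin

text \<open>A choice is made because a class has several representatives and a representative may
  lie in several pieces; \<open>image_unique\<close> shows that the result does not depend on
  it.\<close>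

definition image_pt :: "(real^2) set \<Rightarrow> (real^2) set" where
  "image_pt c = surf_pt (SOME q. \<exists>p\<in>c. \<exists>(R, b)\<in>pieces. p \<in> R \<and> q = A p + b)"

text \<open>Induction along a chain of gluings: \<open>sides\<close> passes from one point to the
  next for some choice of pieces, and \<open>overlap\<close> changes the piece at a fixed point. The
  claim is therefore made for all pieces containing the end of the chain.\<close>

lemma image_unique:
  assumes "surf_pt p = surf_pt p'" "(R, b) \<in> pieces" "p \<in> R" "(R', b') \<in> pieces" "p' \<in> R'"
  shows "surf_pt (A p + b) = surf_pt (A p' + b')"
proof -
  have "\<forall>(R', b')\<in>pieces. p' \<in> R' \<longrightarrow> surf_pt (A p + b) = surf_pt (A p' + b')"
    using assms(1) unfolding surf_pt_eq_iff[of p]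
  proof (induction rule: equivclp_induct)
    case base
    show ?case
    proof clarify
      fix R' b' assume "(R', b') \<in> pieces" "p \<in> R'"
      with overlap[OF assms(2) _ assms(3)] show "surf_pt (A p + b) = surf_pt (A p + b')"
        by (intro glued_imp_surf_pt_eq)
    qed
  next
    case (step q r)
    from step.hyps(2) obtain S c T d where ST: "(S, c) \<in> pieces" "(T, d) \<in> pieces"
      "q \<in> S" "r \<in> T" "surf_pt (A q + c) = surf_pt (A r + d)"
    proof
      assume "side_pairing q r"
      then show thesis using sides[of q r] that by (auto dest: glued_imp_surf_pt_eq)
    next
      assume "side_pairing r q"
      then show thesis using sides[of r q] that by (auto dest: glued_imp_surf_pt_eq[THEN sym])
    qed
    show ?case
    proof clarify
      fix R' b' assume "(R', b') \<in> pieces" "r \<in> R'"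
      then have "surf_pt (A r + d) = surf_pt (A r + b')"
        using overlap[OF ST(2)] ST(4) by (intro glued_imp_surf_pt_eq)
      moreover have "surf_pt (A p + b) = surf_pt (A q + c)"
        using step.IH ST(1,3) by auto
      ultimately show "surf_pt (A p + b) = surf_pt (A r + b')"
        using ST(5) by simp
    qed
  qed
  with assms show ?thesis by auto
qed

lemma image_pt:
  assumes "(R, b) \<in> pieces" "p \<in> R"
  shows "image_pt (surf_pt p) = surf_pt (A p + b)"
proof -
  let ?Q = "\<lambda>q. \<exists>p'\<in>surf_pt p. \<exists>(R, b)\<in>pieces. p' \<in> R \<and> q = A p' + b"
  have "?Q (A p + b)" using assms mem_surf_pt by blast
  then have "?Q (SOME q. ?Q q)" by (rule someI[of ?Q])
  then obtain p' R' b' where *: "p' \<in> surf_pt p" "(R', b') \<in> pieces" "p' \<in> R'"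
    "(SOME q. ?Q q) = A p' + b'" by auto
  have "surf_pt p = surf_pt p'" using *(1) unfolding surf_pt_eq_iff by (simp add: surf_pt_def)
  from image_unique[OF this assms *(2,3)] show ?thesis
    unfolding image_pt_def *(4) by simp
qed

lemma image_pt_eq_singularity:
  assumes "p \<in> L_polygon"
  shows "image_pt (surf_pt p) = singularity \<longleftrightarrow> surf_pt p = singularity"
proof -
  obtain R b where R: "(R, b) \<in> pieces" "p \<in> R" using assms[unfolded cover] by auto
  then show ?thesis
    using vertex_iff[OF R] maps[OF R] assms by (simp add: image_pt surf_pt_eq_singularity)
qed

lemma leaves_image:
  assumes "leaves v \<gamma> t"
  shows "leaves (A v) (\<lambda>t. image_pt (\<gamma> t)) t"
proof -
  obtain p e where p: "e > 0" "\<And>s. 0 \<le> s \<Longrightarrow> s \<le> e \<Longrightarrow> p + s *\<^sub>R v \<in> L_polygon"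
    "\<And>s. 0 \<le> s \<Longrightarrow> s \<le> e \<Longrightarrow> \<gamma> (t + s) = surf_pt (p + s *\<^sub>R v)"
    using assms by (rule leaves_obtain) blast
  obtain R d where R: "R \<in> fst ` pieces" "0 < d" "d \<le> e" "\<And>s. 0 \<le> s \<Longrightarrow> s \<le> d \<Longrightarrow> p + s *\<^sub>R v \<in> R"
  proof (rule finite_closed_convex_cover_germ[of "fst ` pieces" e p v])
    show "p + s *\<^sub>R v \<in> \<Union> (fst ` pieces)" if "0 \<le> s" "s \<le> e" for s
      using p(2)[OF that] cover by force
  qed (use finite_pieces closed_pieces convex_pieces p(1) in auto)
  then obtain b where b: "(R, b) \<in> pieces" by auto
  have image: "A p + b + s *\<^sub>R A v = A (p + s *\<^sub>R v) + b" for s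
    using linear by (simp add: linear_add linear_scale)
  then have "A p + b + s *\<^sub>R A v \<in> L_polygon \<and> image_pt (\<gamma> (t + s)) = surf_pt (A p + b + s *\<^sub>R A v)"
    if "0 \<le> s" "s \<le> d" for s
    unfolding image using that R(3,4) p(3) maps[OF b] image_pt[OF b] by simp
  then show ?thesis unfolding leaves_def using R(2) by blast
qed

lemma arrives_image: "arrives v \<gamma> t \<Longrightarrow> arrives (A v) (\<lambda>t. image_pt (\<gamma> t)) t"
  using leaves_image[of "- v" "\<lambda>s. \<gamma> (- s)" "- t"] linear
  by (simp add: arrives_iff_leaves linear_neg)

lemma periodic_trajectory_image:
  assumes "periodic_trajectory v \<gamma>"
  shows "periodic_trajectory (A v) (\<lambda>t. image_pt (\<gamma> t))"
  unfolding periodic_trajectory_def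
proof (intro conjI allI)
  fix t
  have "leaves v \<gamma> t" "\<gamma> t \<noteq> singularity" using assms by (auto simp: periodic_trajectory_def)
  then show "image_pt (\<gamma> t) \<noteq> singularity"
    by (elim leaves_obtain) (auto simp: image_pt_eq_singularity)
qed (use assms kernel leaves_image arrives_image in \<open>auto simp: periodic_trajectory_def\<close>)

lemma saddle_connection_image:
  assumes "saddle_connection v \<gamma>"
  shows "saddle_connection (A v) (\<lambda>t. image_pt (\<gamma> t))"
proof -
  have "image_pt (\<gamma> t) = singularity \<longleftrightarrow> \<gamma> t = singularity" if "0 \<le> t" "t \<le> 1" for t
  \<comment> \<open>At the final time only \<open>arrives\<close> provides a representative in the
    polygon; before it, \<open>leaves\<close> does.\<close>
  proof (cases "t = 1")
    case True
    then have "arrives v \<gamma> t" using assms by (auto simp: saddle_connection_def)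
    then show ?thesis by (elim arrives_obtain) (auto simp: image_pt_eq_singularity)
  next
    case False
    then have "leaves v \<gamma> t" using assms that by (auto simp: saddle_connection_def)
    then show ?thesis by (elim leaves_obtain) (auto simp: image_pt_eq_singularity)
  qed
  from this this[of 0] this[of 1] show ?thesis
    using assms kernel[of v] leaves_image arrives_image unfolding saddle_connection_def by simp metis
qed

end

section \<open>Three generating automorphisms\<close>

lemmas polygon_simps = L_polygon_def mem_box_cart forall_2 inner_vec_def sum_2

text \<open>The line x = 1 cuts the polygon into two rectangles, each of which is reflected in its
  own vertical midline. In the lower cylinder, of circumference \<phi>, both formulas 1 - x and 1 +
  \<phi> - x describe the same map.\<close>

lemma affine_automorphism_reflection: "affine_automorphism (\<lambda>v. vector [- v $ 1, v $ 2])
  {(cbox (vector [0, 0]) (vector [1, \<phi>]), vector [1, 0]),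
    (cbox (vector [1, 0]) (vector [\<phi>, 1]), vector [1 + \<phi>, 0])}"
  (is "affine_automorphism ?A ?pieces")
proof (rule affine_automorphism.intro)
  show "linear ?A" by (rule linearI) (auto simp: vector2_eq_iff)
  show "L_polygon = (\<Union>(R, b)\<in>?pieces. R)"
    using phi_between_1_2 by (auto simp: polygon_simps)
  fix R b R' b' p q
  show "\<exists>(R, b)\<in>?pieces. \<exists>(R', b')\<in>?pieces. p \<in> R \<and> q \<in> R' \<and> glued (?A p + b) (?A q + b')"
    if "side_pairing p q"
    using that phi_between_1_2
    by (simp add: polygon_simps glued_def side_pairing_iff vector2_eq_iff) (smt (verit))
  have piece_cases: "0 \<le> p $ 1 \<and> 0 \<le> p $ 2 \<and> b $ 2 = 0 \<and>
     (p $ 1 \<le> 1 \<and> p $ 2 \<le> \<phi> \<and> b $ 1 = 1 \<or> 1 \<le> p $ 1 \<and> p $ 1 \<le> \<phi> \<and> p $ 2 \<le> 1 \<and> b $ 1 = 1 + \<phi>)"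
    if "(R, b) \<in> ?pieces" "p \<in> R" for R b
    using that phi_between_1_2 by (auto simp: polygon_simps)
  have A: "(?A p + c) $ 1 = c $ 1 - p $ 1 \<and> (?A p + c) $ 2 = p $ 2 + c $ 2" for c
    by simp
  assume R: "(R, b) \<in> ?pieces" "p \<in> R"
  show "?A p + b \<in> L_polygon" "vertex (?A p + b) \<longleftrightarrow> vertex p"
    using piece_cases[OF R] phi_between_1_2 A[of b]
    unfolding L_polygon_def vertex_def grid_def Un_iff mem_Collect_eq insert_iff empty_iff
    by (smt (verit))+
  show "glued (?A p + b) (?A p + b')" if "(R', b') \<in> ?pieces" "p \<in> R'"
    using piece_cases[OF R] piece_cases[OF that] phi_between_1_2 A[of b] A[of b']
    unfolding glued_def side_pairing_iff vector2_eq_iff by (smt (verit))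
qed (auto simp: vector2_eq_iff)

lemma affine_automorphism_swap: "affine_automorphism (\<lambda>v. vector [v $ 2, v $ 1])
  {(cbox (vector [0, 0]) (vector [1, \<phi>]), 0), (cbox (vector [0, 0]) (vector [\<phi>, 1]), 0)}"
  (is "affine_automorphism ?A ?pieces")
proof (rule affine_automorphism.intro)
  show "linear ?A" by (rule linearI) (auto simp: vector2_eq_iff)
  show "L_polygon = (\<Union>(R, b)\<in>?pieces. R)"
    using phi_between_1_2 by (auto simp: polygon_simps)
  fix R b R' b' p q
  show "\<exists>(R, b)\<in>?pieces. \<exists>(R', b')\<in>?pieces. p \<in> R \<and> q \<in> R' \<and> glued (?A p + b) (?A q + b')"
    if "side_pairing p q"
    using that phi_between_1_2
    by (simp add: polygon_simps glued_def side_pairing_iff vector2_eq_iff) (smt (verit))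
  assume R: "(R, b) \<in> ?pieces" "p \<in> R"
  show "?A p + b \<in> L_polygon" "vertex (?A p + b) \<longleftrightarrow> vertex p"
    using R phi_between_1_2 by (auto simp: polygon_simps vertex_def)
  show "glued (?A p + b) (?A p + b')" if "(R', b') \<in> ?pieces" "p \<in> R'"
    using R that by (auto simp: glued_def)
qed (auto simp: vector2_eq_iff)

text \<open>Both horizontal cylinders have circumference \<open>\<phi>\<close> times their height, so that the shear is a
  full twist of each; the pieces cut them along the lines that it moves to vertical sides.\<close>

lemma affine_automorphism_shear: "affine_automorphism (\<lambda>v. vector [v $ 1 + \<phi> * v $ 2, v $ 2])
  {(cbox (vector [0, 0]) (vector [\<phi>, 1]) \<inter> {p. vector [1, \<phi>] \<bullet> p \<le> \<phi>}, 0),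
    (cbox (vector [0, 0]) (vector [\<phi>, 1]) \<inter> {p. vector [1, \<phi>] \<bullet> p \<ge> \<phi>}, vector [- \<phi>, 0]),
    (cbox (vector [0, 1]) (vector [1, \<phi>]) \<inter> {p. vector [1, \<phi>] \<bullet> p \<le> 1 + \<phi>}, vector [- \<phi>, 0]),
    (cbox (vector [0, 1]) (vector [1, \<phi>]) \<inter> {p. vector [1, \<phi>] \<bullet> p \<ge> 1 + \<phi>}, vector [- \<phi> - 1, 0])}"
  (is "affine_automorphism ?A ?pieces")
proof (rule affine_automorphism.intro)
  have mono: "\<phi> * y \<le> \<phi> * z \<longleftrightarrow> y \<le> z" for y z
    using phi_between_1_2 by (simp add: mult_le_cancel_left_pos)
  \<comment> \<open>With \<open>\<phi> * y\<close> treated as an atom, these comparisons make the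
    conditions on the pieces linear: the values 0, 1, \<phi> of \<open>y\<close> correspond to 0,
    \<phi>, \<phi> + 1.\<close>
  have phi_mult: "0 \<le> \<phi> * y \<longleftrightarrow> 0 \<le> y" "\<phi> * y \<le> \<phi> \<longleftrightarrow> y \<le> 1" "\<phi> \<le> \<phi> * y \<longleftrightarrow> 1 \<le> y"
    "\<phi> * y \<le> \<phi> + 1 \<longleftrightarrow> y \<le> \<phi>" "\<phi> + 1 \<le> \<phi> * y \<longleftrightarrow> \<phi> \<le> y" "\<phi> * y \<le> 0 \<longleftrightarrow> y \<le> 0" for y
    using mono[of 0 y] mono[of y 1] mono[of 1 y] mono[of y \<phi>] mono[of \<phi> y] mono[of y 0]
    unfolding phi_sq by simp_all
  \<comment> \<open>At height 1 the shear has already moved points by \<phi>, so the upper cylinder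
    starts with translation -\<phi>; beyond its right side one turn of length 1 is subtracted in
    addition.\<close>
  have piece_cases: "0 \<le> p $ 1 \<and> 0 \<le> p $ 2 \<and>
     (p $ 1 \<le> \<phi> \<and> p $ 2 \<le> 1 \<and> p $ 1 + \<phi> * p $ 2 \<le> \<phi> \<and> b $ 1 = 0 \<or>
      p $ 1 \<le> \<phi> \<and> p $ 2 \<le> 1 \<and> \<phi> \<le> p $ 1 + \<phi> * p $ 2 \<and> b $ 1 = - \<phi> \<or>
      p $ 1 \<le> 1 \<and> 1 \<le> p $ 2 \<and> p $ 2 \<le> \<phi> \<and> p $ 1 + \<phi> * p $ 2 \<le> 1 + \<phi> \<and> b $ 1 = - \<phi> \<or>
      p $ 1 \<le> 1 \<and> 1 \<le> p $ 2 \<and> p $ 2 \<le> \<phi> \<and> 1 + \<phi> \<le> p $ 1 + \<phi> * p $ 2 \<and> b $ 1 = - \<phi> - 1) \<and>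
     b $ 2 = 0"
    if "(R, b) \<in> ?pieces" "p \<in> R" for R b p
    using that unfolding insert_iff empty_iff prod.inject
    by (elim disjE conjE FalseE; simp add: polygon_simps)
  show "linear ?A" by (rule linearI) (auto simp: vector2_eq_iff algebra_simps)
  have "p $ 1 + \<phi> * p $ 2 \<le> c \<or> c \<le> p $ 1 + \<phi> * p $ 2" for p :: "real^2" and c
    by linarith
  then show "L_polygon = (\<Union>(R, b)\<in>?pieces. R)"
    using phi_between_1_2 by (auto simp: polygon_simps)
  show "finite ?pieces" by simp
  show "v = 0" if "?A v = 0" for v using that by (auto simp: vector2_eq_iff)
  show "closed R" "convex R" if "(R, b) \<in> ?pieces" for R b
    using that by (auto intro!: closed_Int closed_cbox closed_halfspace_le closed_halfspace_ge
      convex_Int convex_box convex_halfspace_le convex_halfspace_ge)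
  show "?A p + b \<in> L_polygon" if "(R, b) \<in> ?pieces" "p \<in> R" for R b p
  proof -
    define u where "u = \<phi> * p $ 2"
    show ?thesis
      using piece_cases[OF that] phi_mult[of "p $ 2"] phi_between_1_2
      unfolding L_polygon_def u_def[symmetric] by (auto simp: u_def[symmetric])
  qed
  show "vertex (?A p + b) \<longleftrightarrow> vertex p" if "(R, b) \<in> ?pieces" "p \<in> R" for R b p
  proof -
    define u where "u = \<phi> * p $ 2"
    have "vertex (?A p + b) \<longleftrightarrow> p $ 1 + u + b $ 1 \<in> {0, 1, \<phi>} \<and> p $ 2 + b $ 2 \<in> {0, 1, \<phi>}"
      by (simp add: vertex_def grid_def u_def)
    then show ?thesis
      using piece_cases[OF that] phi_mult[of "p $ 2"] phi_between_1_2
      unfolding u_def[symmetric] vertex_def grid_def insert_iff empty_iff by (smt (verit))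
  qed
  show "glued (?A p + b) (?A p + b')"
    if "(R, b) \<in> ?pieces" "(R', b') \<in> ?pieces" "p \<in> R" "p \<in> R'" for R b R' b' p
  proof -
    define u where "u = \<phi> * p $ 2"
    have A: "(?A p + c) $ 1 = p $ 1 + u + c $ 1 \<and> (?A p + c) $ 2 = p $ 2 + c $ 2" for c
      by (simp add: u_def)
    show ?thesis
      using piece_cases[OF that(1,3)] piece_cases[OF that(2,4)] phi_mult[of "p $ 2"] phi_between_1_2
        A[of b] A[of b']
      unfolding u_def[symmetric] glued_def side_pairing_iff vector2_eq_iff by (smt (verit))
  qed
  \<comment> \<open>Both copies of a vertical side get the same image. Points of horizontal sides
    are fixed with the pieces chosen below, at height \<phi> because of
    \<open>phi_sq\<close>.\<close>
  show "\<exists>(R, b)\<in>?pieces. \<exists>(R', b')\<in>?pieces. p \<in> R \<and> q \<in> R' \<and> glued (?A p + b) (?A q + b')"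
    if "side_pairing p q" for p q
    using that
  proof cases
    case (1 y)
    show ?thesis
      using 1 phi_between_1_2 phi_mult[of y]
      by (intro bexI[of _ "(cbox (vector [0, 0]) (vector [\<phi>, 1]) \<inter> {p. vector [1, \<phi>] \<bullet> p \<ge> \<phi>}, vector [- \<phi>, 0])"]
          case_prodI
          bexI[of _ "(cbox (vector [0, 0]) (vector [\<phi>, 1]) \<inter> {p. vector [1, \<phi>] \<bullet> p \<le> \<phi>}, 0)"])
        (simp_all add: polygon_simps glued_def side_pairing_iff vector2_eq_iff)
  next
    case (2 y)
    show ?thesis
      using 2 phi_between_1_2 phi_mult[of y]
      by (intro bexI[of _ "(cbox (vector [0, 1]) (vector [1, \<phi>]) \<inter> {p. vector [1, \<phi>] \<bullet> p \<ge> 1 + \<phi>}, vector [- \<phi> - 1, 0])"]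
          case_prodI
          bexI[of _ "(cbox (vector [0, 1]) (vector [1, \<phi>]) \<inter> {p. vector [1, \<phi>] \<bullet> p \<le> 1 + \<phi>}, vector [- \<phi>, 0])"])
        (simp_all add: polygon_simps glued_def side_pairing_iff vector2_eq_iff)
  next
    case (3 x)
    show ?thesis
      using 3 phi_between_1_2
      by (intro bexI[of _ "(cbox (vector [0, 0]) (vector [\<phi>, 1]) \<inter> {p. vector [1, \<phi>] \<bullet> p \<ge> \<phi>}, vector [- \<phi>, 0])"]
          case_prodI
          bexI[of _ "(cbox (vector [0, 0]) (vector [\<phi>, 1]) \<inter> {p. vector [1, \<phi>] \<bullet> p \<le> \<phi>}, 0)"])
        (simp_all add: polygon_simps glued_def side_pairing_iff vector2_eq_iff)
  next
    case (4 x)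
    show ?thesis
      using 4 phi_between_1_2 phi_sq
      by (intro bexI[of _ "(cbox (vector [0, 1]) (vector [1, \<phi>]) \<inter> {p. vector [1, \<phi>] \<bullet> p \<ge> 1 + \<phi>}, vector [- \<phi> - 1, 0])"]
          case_prodI
          bexI[of _ "(cbox (vector [0, 0]) (vector [\<phi>, 1]) \<inter> {p. vector [1, \<phi>] \<bullet> p \<le> \<phi>}, 0)"])
        (simp_all add: polygon_simps glued_def side_pairing_iff vector2_eq_iff)
  qed
qed

section \<open>Cylinder vectors and saddle connection vectors\<close>

definition periodic_vectors :: "(real^2) set" where
  "periodic_vectors = {v. \<exists>\<gamma>. periodic_trajectory v \<gamma>}"

definition saddle_vectors :: "(real^2) set" where
  "saddle_vectors = {v. \<exists>\<gamma>. saddle_connection v \<gamma>}"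

lemma leaves_surf_ptI:
  assumes "\<epsilon> > 0" "\<And>s. 0 \<le> s \<Longrightarrow> s \<le> \<epsilon> \<Longrightarrow>
    p + s *\<^sub>R v \<in> L_polygon \<and> \<gamma> (t + s) = surf_pt (p + s *\<^sub>R v)"
  shows "leaves v \<gamma> t"
  using assms unfolding leaves_def by blast

lemma arrives_surf_ptI:
  assumes "\<epsilon> > 0" "\<And>s. 0 \<le> s \<Longrightarrow> s \<le> \<epsilon> \<Longrightarrow>
    p - s *\<^sub>R v \<in> L_polygon \<and> \<gamma> (t - s) = surf_pt (p - s *\<^sub>R v)"
  shows "arrives v \<gamma> t"
  using assms unfolding arrives_def by blast

lemma horizontal_saddle_connection:
  "saddle_connection (vector [1, 0]) (\<lambda>t. surf_pt (vector [t, 0]))"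
  unfolding saddle_connection_def
proof (intro conjI allI impI; (elim conjE)?)
  have in_L: "vector [x, 0] \<in> L_polygon" if "0 \<le> x" "x \<le> 1" for x
    using that phi_between_1_2 by (simp add: L_polygon_def)
  show "vector [1, 0] \<noteq> (0 :: real^2)" by (simp add: vector2_eq_iff)
  show "surf_pt (vector [0, 0]) = singularity" "surf_pt (vector [1, 0]) = singularity"
    by (simp_all add: surf_pt_eq_singularity in_L vertex_def grid_simps)
  fix t :: real
  have shift: "vector [t, 0] + s *\<^sub>R vector [1, 0] = (vector [t + s, 0] :: real^2)"
    "vector [t, 0] - s *\<^sub>R vector [1, 0] = (vector [t - s, 0] :: real^2)" for s
    by (simp_all add: vector2_eq_iff)
  show "leaves (vector [1, 0]) (\<lambda>t. surf_pt (vector [t, 0])) t" if "0 \<le> t" "t < 1"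
    by (rule leaves_surf_ptI[of "1 - t" "vector [t, 0]"]) (use that in \<open>auto simp: shift intro!: in_L\<close>)
  show "arrives (vector [1, 0]) (\<lambda>t. surf_pt (vector [t, 0])) t" if "0 < t" "t \<le> 1"
    by (rule arrives_surf_ptI[of t "vector [t, 0]"]) (use that in \<open>auto simp: shift intro!: in_L\<close>)
  show "surf_pt (vector [t, 0]) \<noteq> singularity" if "0 < t" "t < 1"
    using that phi_between_1_2 in_L[of t] by (simp add: surf_pt_eq_singularity vertex_def grid_def)
qed

text \<open>The height 3/2 lies between 1 and \<phi>, that is, inside the upper horizontal cylinder,
  whose circumference is 1.\<close>

lemma horizontal_periodic_trajectory:
  "periodic_trajectory (vector [1, 0]) (\<lambda>t. surf_pt (vector [frac t, 3 / 2]))"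
  unfolding periodic_trajectory_def
proof (intro conjI allI)
  have in_L: "vector [x, 3 / 2] \<in> L_polygon" if "0 \<le> x" "x \<le> 1" for x
    using that phi_bounds by (simp add: L_polygon_def)
  show "vector [1, 0] \<noteq> (0 :: real^2)" by (simp add: vector2_eq_iff)
  fix t :: real
  note frac = frac_ge_0[of t] frac_lt_1[of t]
  have shift: "vector [x, 3 / 2] + s *\<^sub>R vector [1, 0] = (vector [x + s, 3 / 2] :: real^2)"
    "vector [x, 3 / 2] - s *\<^sub>R vector [1, 0] = (vector [x - s, 3 / 2] :: real^2)" for x s
    by (simp_all add: vector2_eq_iff)
  have frac_shift: "frac (t + s) = frac t + s" if "0 \<le> frac t + s" "frac t + s < 1" for s
    using that unfolding frac_unique_iff by (simp add: frac_def)
  show "leaves (vector [1, 0]) (\<lambda>t. surf_pt (vector [frac t, 3 / 2])) t"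
  \<comment> \<open>Only half of the remaining distance is used, since \<open>frac\<close> drops to
    0 at the right side.\<close>
  proof (rule leaves_surf_ptI[of "(1 - frac t) / 2" "vector [frac t, 3 / 2]"])
    fix s assume "0 \<le> s" "s \<le> (1 - frac t) / 2"
    with frac frac_shift[of s] in_L[of "frac t + s"]
    show "vector [frac t, 3 / 2] + s *\<^sub>R vector [1, 0] \<in> L_polygon \<and>
      surf_pt (vector [frac (t + s), 3 / 2]) = surf_pt (vector [frac t, 3 / 2] + s *\<^sub>R vector [1, 0])"
      by (simp add: shift)
  qed (use frac in simp)
  show "arrives (vector [1, 0]) (\<lambda>t. surf_pt (vector [frac t, 3 / 2])) t"
  \<comment> \<open>At integer times the trajectory leaves from x = 0 but arrives at x = 1.\<close>
  proof (cases "frac t = 0")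
    case True
    show ?thesis
    proof (rule arrives_surf_ptI[of "1 / 2" "vector [1, 3 / 2]"])
      fix s :: real assume s: "0 \<le> s" "s \<le> 1 / 2"
      have "surf_pt (vector [0, 3 / 2]) = surf_pt (vector [1, 3 / 2])"
        using phi_bounds by (intro glued_imp_surf_pt_eq) (simp add: glued_def side_pairing_iff)
      moreover have "frac (t - s) = 1 - s" if "s \<noteq> 0"
        using that True s by (simp add: frac_unique_iff frac_eq_0_iff)
      ultimately have "surf_pt (vector [frac (t - s), 3 / 2]) = surf_pt (vector [1 - s, 3 / 2])"
        using True by (cases "s = 0") (simp_all only: diff_zero not_False_eq_True simp_thms)
      then show "vector [1, 3 / 2] - s *\<^sub>R vector [1, 0] \<in> L_polygon \<and>
        surf_pt (vector [frac (t - s), 3 / 2]) = surf_pt (vector [1, 3 / 2] - s *\<^sub>R vector [1, 0])"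
        using s in_L[of "1 - s"] by (simp add: shift)
    qed simp
  next
    case False
    show ?thesis
    proof (rule arrives_surf_ptI[of "frac t" "vector [frac t, 3 / 2]"])
      fix s assume "0 \<le> s" "s \<le> frac t"
      with frac frac_shift[of "- s"] in_L[of "frac t - s"]
      show "vector [frac t, 3 / 2] - s *\<^sub>R vector [1, 0] \<in> L_polygon \<and>
        surf_pt (vector [frac (t - s), 3 / 2]) = surf_pt (vector [frac t, 3 / 2] - s *\<^sub>R vector [1, 0])"
        by (simp add: shift)
    qed (use frac False in simp)
  qed
  show "surf_pt (vector [frac t, 3 / 2]) \<noteq> singularity"
    using frac phi_bounds in_L[of "frac t"]
    by (simp add: surf_pt_eq_singularity vertex_def grid_def)
  show "surf_pt (vector [frac (t + 1), 3 / 2]) = surf_pt (vector [frac t, 3 / 2])"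
    by (simp add: frac_1_eq)
qed

section \<open>From cylinders to periodic trajectories\<close>

lemma trajectory_continuous:
  assumes "\<And>t. leaves v \<gamma> t" "\<And>t. arrives v \<gamma> t"
  shows "continuous_map euclideanreal golden_L \<gamma>"
  unfolding continuous_map_def
proof (intro conjI allI impI)
  show "\<gamma> \<in> topspace euclideanreal \<rightarrow> topspace golden_L"
  proof
    fix t show "\<gamma> t \<in> topspace golden_L"
      by (rule leaves_obtain[OF assms(1)[of t]]) (simp add: topspace_golden_L)
  qed
  fix U assume "openin golden_L U"
  define W where "W = {p \<in> L_polygon. surf_pt p \<in> U}"
  have W: "\<exists>e>0. \<forall>q\<in>L_polygon. dist q p < e \<longrightarrow> q \<in> W" if "p \<in> W" for p
    using \<open>openin golden_L U\<close> that
    unfolding openin_golden_L openin_euclidean_subtopology_iff W_def[symmetric] by blast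
  have nearby: "\<exists>d>0. \<forall>s. 0 \<le> s \<and> s < d \<longrightarrow> p + s *\<^sub>R w \<in> W"
    if p: "p \<in> W" "\<epsilon> > 0" and in_L: "\<And>s. 0 \<le> s \<Longrightarrow> s \<le> \<epsilon> \<Longrightarrow> p + s *\<^sub>R w \<in> L_polygon" for p w \<epsilon>
  proof -
    obtain e where e: "e > 0" "\<And>q. q \<in> L_polygon \<Longrightarrow> dist q p < e \<Longrightarrow> q \<in> W"
      using W[OF p(1)] by blast
    define d where "d = min \<epsilon> (e / (norm w + 1))"
    have "d > 0" using e(1) p(2) by (simp add: d_def add_nonneg_pos)
    moreover have "p + s *\<^sub>R w \<in> W" if s: "0 \<le> s" "s < d" for s
    proof (rule e(2))
      show "p + s *\<^sub>R w \<in> L_polygon" using s in_L by (simp add: d_def)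
      have "s * (norm w + 1) < e"
        using s by (simp add: d_def pos_less_divide_eq add_nonneg_pos)
      then show "dist (p + s *\<^sub>R w) p < e"
        using s by (simp add: dist_norm algebra_simps)
    qed
    ultimately show ?thesis by blast
  qed
  have "open (\<gamma> -` U)"
    unfolding open_dist
  proof
    fix t assume t: "t \<in> \<gamma> -` U"
    obtain p a where p: "a > 0" "\<And>s. 0 \<le> s \<Longrightarrow> s \<le> a \<Longrightarrow> p + s *\<^sub>R v \<in> L_polygon"
      "\<And>s. 0 \<le> s \<Longrightarrow> s \<le> a \<Longrightarrow> \<gamma> (t + s) = surf_pt (p + s *\<^sub>R v)" "p \<in> L_polygon" "\<gamma> t = surf_pt p"
      using assms(1) by (rule leaves_obtain) blast
    obtain q b where q: "b > 0" "\<And>s. 0 \<le> s \<Longrightarrow> s \<le> b \<Longrightarrow> q - s *\<^sub>R v \<in> L_polygon"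
      "\<And>s. 0 \<le> s \<Longrightarrow> s \<le> b \<Longrightarrow> \<gamma> (t - s) = surf_pt (q - s *\<^sub>R v)" "q \<in> L_polygon" "\<gamma> t = surf_pt q"
      using assms(2) by (rule arrives_obtain) blast
    have "p \<in> W" "q \<in> W" using t p(4,5) q(4,5) by (auto simp: W_def)
    obtain c where c: "c > 0" "\<And>s. 0 \<le> s \<Longrightarrow> s < c \<Longrightarrow> p + s *\<^sub>R v \<in> W"
      using nearby[OF \<open>p \<in> W\<close> p(1,2)] by blast
    obtain d where d: "d > 0" "\<And>s. 0 \<le> s \<Longrightarrow> s < d \<Longrightarrow> q - s *\<^sub>R v \<in> W"
      using nearby[OF \<open>q \<in> W\<close> q(1), of "- v"] q(2) by auto
    \<comment> \<open>The two representatives of \<open>\<gamma> t\<close> both lie in the preimage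
      \<open>W\<close>, and the two germs give the one-sided neighbourhoods of
      \<open>t\<close>.\<close>
    have "\<gamma> u \<in> U" if "dist u t < min (min a b) (min c d)" for u
    proof (cases "t \<le> u")
      case True
      then show ?thesis
        using that p(3)[of "u - t"] c(2)[of "u - t"] by (simp add: dist_real_def W_def)
    next
      case False
      then show ?thesis
        using that q(3)[of "t - u"] d(2)[of "t - u"] by (simp add: dist_real_def W_def)
    qed
    then show "\<exists>e>0. \<forall>u. dist u t < e \<longrightarrow> u \<in> \<gamma> -` U"
      using p(1) q(1) c(1) d(1) by (intro exI[of _ "min (min a b) (min c d)"]) auto
  qed
  then show "openin euclideanreal {x \<in> topspace euclideanreal. \<gamma> x \<in> U}"
    by (simp add: vimage_def)
qed

text \<open>The range of a trajectory is connected, as a continuous image of the line, so some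
  connected component of the periodic points contains it.\<close>

lemma cylinder_iff_primitive_trajectory:
  "(\<exists>C. cylinder C v) \<longleftrightarrow> (\<exists>\<gamma>. primitive_trajectory v \<gamma>)"
proof
  assume "\<exists>\<gamma>. primitive_trajectory v \<gamma>"
  then obtain \<gamma> where \<gamma>: "primitive_trajectory v \<gamma>" ..
  then have traj: "\<And>t. leaves v \<gamma> t" "\<And>t. arrives v \<gamma> t"
    by (auto simp: primitive_trajectory_def periodic_trajectory_def)
  let ?X = "subtopology golden_L (periodic_points v)"
  have "same_direction v v" unfolding same_direction_def by (intro exI[of _ 1]) simp
  then have sub: "range \<gamma> \<subseteq> periodic_points v"
    using \<gamma> unfolding periodic_points_def by blast
  have "connectedin golden_L (range \<gamma>)"
    using connectedin_continuous_map_image[OF trajectory_continuous[OF traj], of UNIV] by simp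
  then have conn: "connectedin ?X (range \<gamma>)" using sub by (simp add: connectedin_subtopology)
  then have "?X \<noteq> trivial_topology"
    using connectedin_subset_topspace by fastforce
  with conn obtain C where "C \<in> connected_components_of ?X" "range \<gamma> \<subseteq> C"
    using exists_connected_component_of_superset by blast
  with \<gamma> show "\<exists>C. cylinder C v" unfolding cylinder_def by blast
qed (auto simp: cylinder_def)

lemma leaves_rescale:
  assumes "leaves v \<gamma> (c * t)" "c > 0"
  shows "leaves (c *\<^sub>R v) (\<lambda>t. \<gamma> (c * t)) t"
proof -
  obtain p e where p: "e > 0" "\<And>s. 0 \<le> s \<Longrightarrow> s \<le> e \<Longrightarrow> p + s *\<^sub>R v \<in> L_polygon"
    "\<And>s. 0 \<le> s \<Longrightarrow> s \<le> e \<Longrightarrow> \<gamma> (c * t + s) = surf_pt (p + s *\<^sub>R v)"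
    using assms(1) by (rule leaves_obtain) blast
  show ?thesis
  proof (rule leaves_surf_ptI[of "e / c" p])
    fix s assume "0 \<le> s" "s \<le> e / c"
    then show "p + s *\<^sub>R c *\<^sub>R v \<in> L_polygon \<and> \<gamma> (c * (t + s)) = surf_pt (p + s *\<^sub>R c *\<^sub>R v)"
      using p(2)[of "c * s"] p(3)[of "c * s"] assms(2)
      by (simp add: algebra_simps pos_le_divide_eq)
  qed (use p assms in simp)
qed

lemma arrives_rescale:
  "arrives v \<gamma> (c * t) \<Longrightarrow> c > 0 \<Longrightarrow> arrives (c *\<^sub>R v) (\<lambda>t. \<gamma> (c * t)) t"
  using leaves_rescale[of "- v" "\<lambda>s. \<gamma> (- s)" c "- t"] by (simp add: arrives_iff_leaves)

lemma periodic_trajectory_rescale: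
  assumes "periodic_trajectory v \<gamma>" "c > 0" "\<And>t. \<gamma> (t + c) = \<gamma> t"
  shows "periodic_trajectory (c *\<^sub>R v) (\<lambda>t. \<gamma> (c * t))"
  using assms leaves_rescale arrives_rescale
  by (simp add: periodic_trajectory_def distrib_left)

text \<open>If a period less than 1 exists, then there is one that is at most 1/2, because the
  difference of two periods is a period. Halving must stop since holonomies are bounded below.\<close>

lemma periodic_trajectory_imp_primitive:
  assumes "periodic_trajectory v \<gamma>" "v $ 1 > 0"
  shows "\<exists>c \<delta>. 0 < c \<and> c \<le> 1 \<and> primitive_trajectory (c *\<^sub>R v) \<delta>"
proof -
  obtain n where "v $ 1 < 2 ^ n" using real_arch_pow[of 2 "v $ 1"] by auto
  with assms show ?thesis
  proof (induction n arbitrary: v \<gamma>)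
    case 0
    then show ?case using periodic_trajectory_coord_1_ge by fastforce
  next
    case (Suc n)
    show ?case
    proof (cases "primitive_trajectory v \<gamma>")
      case True
      then show ?thesis by (intro exI[of _ 1]) auto
    next
      case False
      then obtain s where s: "0 < s" "s < 1" "\<And>t. \<gamma> (t + s) = \<gamma> t"
        using Suc.prems unfolding primitive_trajectory_def by blast
      have "\<gamma> (t + (1 - s)) = \<gamma> t" for t
        using s(3)[of "t + (1 - s)"] Suc.prems(1) by (simp add: periodic_trajectory_def)
      with s obtain r where r: "0 < r" "r \<le> 1 / 2" "\<And>t. \<gamma> (t + r) = \<gamma> t"
        by (cases "s \<le> 1 / 2") (use that[of s] that[of "1 - s"] in auto)
      have "r * v $ 1 \<le> 1 / 2 * v $ 1"
        using r Suc.prems(2) by (intro mult_right_mono) auto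
      then have "(r *\<^sub>R v) $ 1 < 2 ^ n" using Suc.prems(3) by simp
      then obtain c \<delta> where "0 < c" "c \<le> 1" "primitive_trajectory (c *\<^sub>R r *\<^sub>R v) \<delta>"
        using Suc.IH[OF periodic_trajectory_rescale[OF Suc.prems(1) r(1,3)]] r(1) Suc.prems(2) by auto
      then show ?thesis
        using r mult_le_one[of c r] by (intro exI[of _ "c * r"] exI[of _ \<delta>]) auto
    qed
  qed
qed

text \<open>Vectors of the same direction are positive multiples, so comparing norms amounts to
  comparing a factor with 1. In this form the condition commutes with linear maps.\<close>

definition shortest :: "(real^2) set \<Rightarrow> (real^2) set" where
  "shortest Z = {v \<in> Z. \<forall>c>0. c *\<^sub>R v \<in> Z \<longrightarrow> 1 \<le> c}"

definition longest :: "(real^2) set \<Rightarrow> (real^2) set" where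
  "longest Z = {v \<in> Z. \<forall>c>0. c *\<^sub>R v \<in> Z \<longrightarrow> c \<le> 1}"

lemma long_saddle_connection_vectors_eq: "long_saddle_connection_vectors = longest saddle_vectors"
proof -
  have "(\<forall>\<delta> w. saddle_connection w \<delta> \<and> same_direction v w \<longrightarrow> norm w \<le> norm v) \<longleftrightarrow>
      (\<forall>c>0. c *\<^sub>R v \<in> saddle_vectors \<longrightarrow> c \<le> 1)" if "saddle_connection v \<gamma>" for v \<gamma>
  proof -
    have "norm v > 0" using that by (simp add: saddle_connection_def)
    then have "norm (c *\<^sub>R v) \<le> norm v \<longleftrightarrow> c \<le> 1" if "c > 0" for c
      using that by simp
    then show ?thesis unfolding same_direction_def saddle_vectors_def by blast
  qed
  then show ?thesis
    unfolding long_saddle_connection_vectors_def longest_def saddle_vectors_def by blast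
qed

lemma short_cylinder_vectors_iff:
  "v \<in> short_cylinder_vectors \<longleftrightarrow> v \<in> shortest {v. \<exists>\<gamma>. primitive_trajectory v \<gamma>}"
proof -
  have "(\<forall>D w. cylinder D w \<and> same_direction v w \<longrightarrow> norm v \<le> norm w) \<longleftrightarrow>
      (\<forall>c>0. (\<exists>D. cylinder D (c *\<^sub>R v)) \<longrightarrow> 1 \<le> c)" if "primitive_trajectory v \<gamma>" for \<gamma>
  proof -
    have "norm v > 0" using that by (simp add: primitive_trajectory_def periodic_trajectory_def)
    then have "norm v \<le> norm (c *\<^sub>R v) \<longleftrightarrow> 1 \<le> c" if "c > 0" for c
      using that by simp
    then show ?thesis unfolding same_direction_def by blast
  qed
  note shortest_iff = this
  have "v \<in> short_cylinder_vectors \<longleftrightarrow> (\<exists>C. cylinder C v) \<and>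
      (\<forall>D w. cylinder D w \<and> same_direction v w \<longrightarrow> norm v \<le> norm w)"
    unfolding short_cylinder_vectors_def by blast
  then show ?thesis
    using shortest_iff unfolding cylinder_iff_primitive_trajectory shortest_def by blast
qed

text \<open>Every periodic holonomy vector with positive first coordinate has a primitive multiple
  by some \<open>c \<le> 1\<close>, so admitting imprimitive ones does not change the minimal
  vectors.\<close>

lemma short_cylinder_vectors_eq:
  assumes "v $ 1 > 0"
  shows "v \<in> short_cylinder_vectors \<longleftrightarrow> v \<in> shortest periodic_vectors"
proof -
  let ?Z = "{v. \<exists>\<gamma>. primitive_trajectory v \<gamma>}"
  have prim: "?Z \<subseteq> periodic_vectors"
    by (auto simp: primitive_trajectory_def periodic_vectors_def)
  have shrink: "\<exists>c. 0 < c \<and> c \<le> 1 \<and> c *\<^sub>R w \<in> ?Z" if "w \<in> periodic_vectors" "w $ 1 > 0" for w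
    using that periodic_trajectory_imp_primitive by (fastforce simp: periodic_vectors_def)
  show ?thesis
  proof
    assume "v \<in> short_cylinder_vectors"
    then have v: "v \<in> ?Z" "\<And>c. c > 0 \<Longrightarrow> c *\<^sub>R v \<in> ?Z \<Longrightarrow> 1 \<le> c"
      by (auto simp: short_cylinder_vectors_iff shortest_def)
    have "1 \<le> c" if c: "c > 0" "c *\<^sub>R v \<in> periodic_vectors" for c
    proof -
      obtain d where d: "0 < d" "d \<le> 1" "d *\<^sub>R c *\<^sub>R v \<in> ?Z"
        using shrink[OF c(2)] c(1) assms by auto
      then have "1 \<le> d * c" using v(2)[of "d * c"] c(1) by simp
      also have "\<dots> \<le> 1 * c" using d c by (intro mult_right_mono) auto
      finally show ?thesis by simp
    qed
    then show "v \<in> shortest periodic_vectors" using v(1) prim by (auto simp: shortest_def)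
  next
    assume v: "v \<in> shortest periodic_vectors"
    then obtain c where c: "0 < c" "c \<le> 1" "c *\<^sub>R v \<in> ?Z"
      using shrink[of v] assms by (auto simp: shortest_def)
    then have "c = 1" using v prim by (force simp: shortest_def)
    then have "v \<in> ?Z" using c by simp
    then show "v \<in> short_cylinder_vectors"
      using v prim unfolding short_cylinder_vectors_iff by (auto simp: shortest_def)
  qed
qed

section \<open>Words\<close>

lemma phi_phi_mult: "\<phi> * (\<phi> * z) = \<phi> * z + z"
  using phi_sq by (simp flip: mult.assoc add: distrib_right)

lemma phi_mult_ge: "0 \<le> z \<Longrightarrow> z \<le> \<phi> * z"
  using mult_right_mono[of 1 \<phi> z] phi_between_1_2 by simp

lemma sigma_mult:
  "\<sigma>\<^sub>0 *v v = vector [v $ 1 + \<phi> * v $ 2, v $ 2]"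
  "\<sigma>\<^sub>1 *v v = vector [\<phi> * v $ 1 + \<phi> * v $ 2, v $ 1 + \<phi> * v $ 2]"
  "\<sigma>\<^sub>2 *v v = vector [\<phi> * v $ 1 + v $ 2, \<phi> * v $ 1 + \<phi> * v $ 2]"
  "\<sigma>\<^sub>3 *v v = vector [v $ 1, \<phi> * v $ 1 + v $ 2]"
  by (simp_all add: vector2_eq_iff matrix_vector_mult_def sum_2 \<sigma>\<^sub>0_def \<sigma>\<^sub>1_def \<sigma>\<^sub>2_def \<sigma>\<^sub>3_def)

lemma word_vector_Nil: "word_vector [] = vector [1, 0]"
  by (simp add: word_vector_def)

text \<open>The last letter acts last, so the inductions on word vectors remove letters from the
  end.\<close>

lemma word_matrix_snoc: "word_matrix (w @ [\<sigma>]) = \<sigma> ** word_matrix w"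
  by (induction w) (simp_all add: matrix_mul_assoc)

lemma word_vector_snoc: "word_vector (w @ [\<sigma>]) = \<sigma> *v word_vector w"
  by (simp add: word_vector_def word_matrix_snoc matrix_vector_mul_assoc)

text \<open>\<open>\<sigma>\<^sub>0\<close> fixes (1, 0). This is the only source of non-uniqueness
  of words.\<close>

lemma word_vector_Cons_sigma_0: "word_vector (\<sigma>\<^sub>0 # w) = word_vector w"
proof -
  have "word_vector (\<sigma>\<^sub>0 # w) = word_matrix w *v (\<sigma>\<^sub>0 *v vector [1, 0])"
    by (simp add: word_vector_def matrix_vector_mul_assoc)
  then show ?thesis by (simp add: sigma_mult word_vector_def)
qed

lemma positive_cone_sigma:
  assumes "v \<in> positive_cone" "\<sigma> \<in> alphabet"
  shows "\<sigma> *v v \<in> positive_cone"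
proof -
  have "v $ 1 > 0" "v $ 2 \<ge> 0" using assms(1) by (simp_all add: positive_cone_def)
  moreover from this have "v $ 1 \<le> \<phi> * v $ 1" "v $ 2 \<le> \<phi> * v $ 2"
    by (simp_all add: phi_mult_ge)
  ultimately show ?thesis
    using assms(2) unfolding alphabet_def positive_cone_def
    by (elim insertE emptyE; simp only: sigma_mult mem_Collect_eq vector_2; linarith)
qed

lemma word_vector_positive_cone: "w \<in> lists alphabet \<Longrightarrow> word_vector w \<in> positive_cone"
proof (induction w rule: rev_induct)
  case Nil
  then show ?case by (simp add: word_vector_Nil positive_cone_def)
next
  case (snoc \<sigma> w)
  then show ?case by (simp add: word_vector_snoc positive_cone_sigma)
qed

text \<open>The four sectors separated by the directions of \<open>(\<phi>, 1)\<close>, \<open>(1, 1)\<close> and \<open>(1, \<phi>)\<close>.\<close>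

lemma sigma_sector:
  assumes "v \<in> positive_cone"
  shows "\<sigma>\<^sub>0 *v v = w \<Longrightarrow> w $ 1 > \<phi> * w $ 2"
    "\<sigma>\<^sub>1 *v v = w \<Longrightarrow> w $ 1 \<le> \<phi> * w $ 2 \<and> w $ 1 > w $ 2"
    "\<sigma>\<^sub>2 *v v = w \<Longrightarrow> w $ 1 \<le> w $ 2 \<and> \<phi> * w $ 1 > w $ 2"
    "\<sigma>\<^sub>3 *v v = w \<Longrightarrow> w $ 1 \<le> w $ 2 \<and> \<phi> * w $ 1 \<le> w $ 2"
proof -
  have "v $ 1 > 0" "v $ 2 \<ge> 0" using assms by (auto simp: positive_cone_def)
  moreover from this have "v $ 1 < \<phi> * v $ 1" "v $ 2 \<le> \<phi> * v $ 2"
    using phi_between_1_2 by (simp_all add: phi_mult_ge)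
  ultimately show "\<sigma>\<^sub>0 *v v = w \<Longrightarrow> w $ 1 > \<phi> * w $ 2"
    "\<sigma>\<^sub>1 *v v = w \<Longrightarrow> w $ 1 \<le> \<phi> * w $ 2 \<and> w $ 1 > w $ 2"
    "\<sigma>\<^sub>2 *v v = w \<Longrightarrow> w $ 1 \<le> w $ 2 \<and> \<phi> * w $ 1 > w $ 2"
    "\<sigma>\<^sub>3 *v v = w \<Longrightarrow> w $ 1 \<le> w $ 2 \<and> \<phi> * w $ 1 \<le> w $ 2"
    by (hypsubst, unfold sigma_mult vector_2 distrib_left phi_phi_mult, linarith)+
qed

lemma sigma_inverse:
  "\<sigma>\<^sub>0 *v vector [x - \<phi> * y, y] = vector [x, y]"
  "\<sigma>\<^sub>1 *v vector [\<phi> * x - \<phi> * y, \<phi> * y - x] = vector [x, y]"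
  "\<sigma>\<^sub>2 *v vector [\<phi> * x - y, \<phi> * y - \<phi> * x] = vector [x, y]"
  "\<sigma>\<^sub>3 *v vector [x, y - \<phi> * x] = vector [x, y]"
proof -
  show "\<sigma>\<^sub>0 *v vector [x - \<phi> * y, y] = vector [x, y]"
    "\<sigma>\<^sub>1 *v vector [\<phi> * x - \<phi> * y, \<phi> * y - x] = vector [x, y]"
    "\<sigma>\<^sub>2 *v vector [\<phi> * x - y, \<phi> * y - \<phi> * x] = vector [x, y]"
    "\<sigma>\<^sub>3 *v vector [x, y - \<phi> * x] = vector [x, y]"
    by (simp_all add: sigma_mult vector2_eq_iff right_diff_distrib phi_phi_mult)
qed

lemma sigma_inj:
  assumes "\<sigma> \<in> alphabet" "\<sigma> *v v = \<sigma> *v w"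
  shows "v = w"
proof -
  have left_inverse: "v = vector [(\<sigma>\<^sub>0 *v v) $ 1 - \<phi> * (\<sigma>\<^sub>0 *v v) $ 2, (\<sigma>\<^sub>0 *v v) $ 2]"
    "v = vector [\<phi> * (\<sigma>\<^sub>1 *v v) $ 1 - \<phi> * (\<sigma>\<^sub>1 *v v) $ 2, \<phi> * (\<sigma>\<^sub>1 *v v) $ 2 - (\<sigma>\<^sub>1 *v v) $ 1]"
    "v = vector [\<phi> * (\<sigma>\<^sub>2 *v v) $ 1 - (\<sigma>\<^sub>2 *v v) $ 2, \<phi> * (\<sigma>\<^sub>2 *v v) $ 2 - \<phi> * (\<sigma>\<^sub>2 *v v) $ 1]"
    "v = vector [(\<sigma>\<^sub>3 *v v) $ 1, (\<sigma>\<^sub>3 *v v) $ 2 - \<phi> * (\<sigma>\<^sub>3 *v v) $ 1]" for v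
    by (simp_all add: sigma_mult vector2_eq_iff[of v] distrib_left phi_phi_mult)
  from assms(1) consider "\<sigma> = \<sigma>\<^sub>0" | "\<sigma> = \<sigma>\<^sub>1" | "\<sigma> = \<sigma>\<^sub>2" | "\<sigma> = \<sigma>\<^sub>3"
    unfolding alphabet_def by blast
  then show ?thesis
    by cases (use assms(2) left_inverse in metis)+
qed

lemma sigma_unique:
  assumes "v \<in> positive_cone" "w \<in> positive_cone" "\<sigma> \<in> alphabet" "\<tau> \<in> alphabet"
    and eq: "\<sigma> *v v = \<tau> *v w"
  shows "\<sigma> = \<tau> \<and> v = w"
proof -
  define u where "u = \<tau> *v w"
  then have "u \<in> positive_cone" using assms positive_cone_sigma by simp
  \<comment> \<open>Separates the sector of \<open>\<sigma>\<^sub>0\<close> from those of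
    \<open>\<sigma>\<^sub>2\<close> and \<open>\<sigma>\<^sub>3\<close>; the other pairs exclude
    each other literally.\<close>
  then have "u $ 2 \<le> \<phi> * u $ 2" using phi_mult_ge by (simp add: positive_cone_def)
  then have "\<sigma> = \<tau>"
    using assms(3,4) sigma_sector[OF assms(1), of u] sigma_sector[OF assms(2), of u] eq u_def
    unfolding alphabet_def by (elim insertE emptyE; simp; fastforce)
  then show ?thesis using sigma_inj assms by metis
qed

section \<open>Uniqueness of words\<close>

definition reduced_word :: "(real^2^2) list \<Rightarrow> bool" where
  "reduced_word w \<longleftrightarrow> w \<in> lists alphabet \<and> (w = [] \<or> hd w \<noteq> \<sigma>\<^sub>0)"

lemma reduced_word_snoc: "reduced_word (w @ [\<sigma>]) \<Longrightarrow> reduced_word w \<and> \<sigma> \<in> alphabet \<and> (w = [] \<longrightarrow> \<sigma> \<noteq> \<sigma>\<^sub>0)"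
  by (auto simp: reduced_word_def)

text \<open>Since (1, 0) is its own image under \<open>\<sigma>\<^sub>0\<close>, the last letter
  must be \<open>\<sigma>\<^sub>0\<close> and the rest again gives (1, 0). By induction the rest is
  empty, so the word would start with \<open>\<sigma>\<^sub>0\<close>.\<close>

lemma word_vector_eq_horizontal:
  "reduced_word w \<Longrightarrow> word_vector w = vector [1, 0] \<Longrightarrow> w = []"
proof (induction w rule: rev_induct)
  case (snoc \<sigma> w)
  then have w: "reduced_word w" "\<sigma> \<in> alphabet" "w = [] \<longrightarrow> \<sigma> \<noteq> \<sigma>\<^sub>0" using reduced_word_snoc by auto
  have "\<sigma> *v word_vector w = \<sigma>\<^sub>0 *v vector [1, 0]"
    using snoc.prems by (simp add: word_vector_snoc sigma_mult)
  moreover have "word_vector w \<in> positive_cone"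
    using w word_vector_positive_cone by (simp add: reduced_word_def)
  ultimately have "\<sigma> = \<sigma>\<^sub>0 \<and> word_vector w = vector [1, 0]"
    using w by (intro sigma_unique) (auto simp: alphabet_def positive_cone_def)
  then show ?case using snoc.IH w by auto
qed simp

lemma word_vector_inj: "inj_on word_vector {w. reduced_word w}"
proof (rule inj_onI, clarify)
  fix w w' assume "reduced_word w" "reduced_word w'" "word_vector w = word_vector w'"
  then show "w = w'"
  proof (induction w arbitrary: w' rule: rev_induct)
    case Nil
    then show ?case using word_vector_eq_horizontal[of w'] by (simp add: word_vector_Nil)
  next
    case (snoc \<sigma> w)
    show ?case
    proof (cases w' rule: rev_cases)
      case Nil
      then show ?thesis
        using snoc.prems word_vector_eq_horizontal[of "w @ [\<sigma>]"] by (simp add: word_vector_Nil)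
    next
      case (snoc u \<tau>)
      have w: "reduced_word w" "\<sigma> \<in> alphabet" "reduced_word u" "\<tau> \<in> alphabet"
        using snoc.prems reduced_word_snoc unfolding snoc by auto
      then have "\<sigma> = \<tau> \<and> word_vector w = word_vector u"
        using snoc.prems(3) unfolding snoc word_vector_snoc
        by (intro sigma_unique word_vector_positive_cone) (auto simp: reduced_word_def)
      then show ?thesis using snoc.IH w snoc by simp
    qed
  qed
qed

lemma word_vector_reduced_image: "word_vector ` {w. reduced_word w} = word_vector ` lists alphabet"
proof
  have "\<exists>w'. reduced_word w' \<and> word_vector w' = word_vector w" if "w \<in> lists alphabet" for w
    using that
  proof (induction w)
    case Nil
    then show ?case by (auto simp: reduced_word_def)
  next
    case (Cons \<sigma> w)
    then show ?case
      by (cases "\<sigma> = \<sigma>\<^sub>0") (auto simp: word_vector_Cons_sigma_0 reduced_word_def intro!: exI[of _ "\<sigma> # w"])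
  qed
  then show "word_vector ` lists alphabet \<subseteq> word_vector ` {w. reduced_word w}"
    by (metis (mono_tags, lifting) image_eqI image_subsetI mem_Collect_eq)
qed (auto simp: reduced_word_def)

section \<open>Descent in invariant sets\<close>

definition veech_invariant :: "(real^2) set \<Rightarrow> bool" where
  "veech_invariant Z \<longleftrightarrow> (\<forall>v\<in>Z. vector [- v $ 1, v $ 2] \<in> Z \<and> vector [v $ 2, v $ 1] \<in> Z \<and>
     vector [v $ 1 + \<phi> * v $ 2, v $ 2] \<in> Z)"

text \<open>The last membership holds because the reflection conjugates the shear to its
  inverse.\<close>

lemma veech_invariantD:
  assumes "veech_invariant Z" "vector [x, y] \<in> Z"
  shows "vector [- x, y] \<in> Z" "vector [y, x] \<in> Z" "vector [x + \<phi> * y, y] \<in> Z"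
    "vector [x - \<phi> * y, y] \<in> Z"
proof -
  have *: "vector [- x, y] \<in> Z" "vector [y, x] \<in> Z" "vector [x + \<phi> * y, y] \<in> Z"
    if "vector [x, y] \<in> Z" for x y
    using assms(1) that unfolding veech_invariant_def by (force dest!: bspec)+
  show "vector [- x, y] \<in> Z" "vector [y, x] \<in> Z" "vector [x + \<phi> * y, y] \<in> Z"
    using *[OF assms(2)] by simp_all
  show "vector [x - \<phi> * y, y] \<in> Z"
    using *(1)[OF *(3)[OF *(1)[OF assms(2)]]] by simp
qed

text \<open>With \<open>R\<close> the rotation by a right angle, \<open>\<sigma>\<^sub>1 = \<sigma>\<^sub>0 R \<sigma>\<^sub>0\<close>; exchanging the
  coordinates turns \<open>\<sigma>\<^sub>0\<close>, \<open>\<sigma>\<^sub>1\<close> into \<open>\<sigma>\<^sub>3\<close>, \<open>\<sigma>\<^sub>2\<close>.\<close>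

lemma veech_invariant_sigma:
  assumes Z: "veech_invariant Z" and v: "v \<in> Z" and \<sigma>: "\<sigma> \<in> alphabet"
  shows "\<sigma> *v v \<in> Z"
proof -
  note D = veech_invariantD[OF Z]
  obtain x y where xy: "v = vector [x, y]" using vector2_eta by blast
  have "vector [\<phi> * x + \<phi> * y, x + \<phi> * y] \<in> Z" if "vector [x, y] \<in> Z" for x y
    using D(3)[OF D(1)[OF D(2)[OF D(3)[OF that]]]] by (simp add: distrib_left phi_phi_mult add_ac)
  note one = this
  have "vector [x, y] \<in> Z" using v xy by simp
  from D(3)[OF this] one[OF this] D(2)[OF one[OF D(2)[OF this]]] D(2)[OF D(3)[OF D(2)[OF this]]]
  show ?thesis using \<sigma> by (auto simp: alphabet_def sigma_mult xy add_ac)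
qed

text \<open>Inverts the factorisation of \<open>\<sigma>\<^sub>1\<close> into shear, rotation and
  shear; conjugation by the exchange of coordinates gives the other two inverses.\<close>

lemma veech_invariant_sigma_inverse:
  assumes Z: "veech_invariant Z" and v: "vector [x, y] \<in> Z"
  shows "vector [x - \<phi> * y, y] \<in> Z" "vector [\<phi> * x - \<phi> * y, \<phi> * y - x] \<in> Z"
    "vector [\<phi> * x - y, \<phi> * y - \<phi> * x] \<in> Z" "vector [x, y - \<phi> * x] \<in> Z"
proof -
  note D = veech_invariantD[OF Z]
  have one: "vector [\<phi> * x - \<phi> * y, \<phi> * y - x] \<in> Z" if "vector [x, y] \<in> Z" for x y
    using D(4)[OF D(2)[OF D(1)[OF D(4)[OF that]]]] by (simp add: right_diff_distrib phi_phi_mult)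
  show "vector [x - \<phi> * y, y] \<in> Z" "vector [\<phi> * x - \<phi> * y, \<phi> * y - x] \<in> Z" "vector [x, y - \<phi> * x] \<in> Z"
    "vector [\<phi> * x - y, \<phi> * y - \<phi> * x] \<in> Z"
    using D(4)[OF v] one[OF v] D(2)[OF D(4)[OF D(2)[OF v]]] D(2)[OF one[OF D(2)[OF v]]] by simp_all
qed

text \<open>A slow continued fraction algorithm: applying the inverse of the \<open>\<sigma>\<^sub>i\<close> whose sector contains
  the vector decreases the sum of its coordinates by at least \<open>c\<close>.\<close>

lemma word_vectors_eq:
  assumes Z: "veech_invariant Z" and e: "vector [1, 0] \<in> Z"
    and c: "c > 0" "\<And>v. v \<in> Z \<Longrightarrow> v $ 1 > 0 \<Longrightarrow> c \<le> v $ 1"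
    and horizontal: "\<And>x. x > 0 \<Longrightarrow> vector [x, 0] \<in> Z \<Longrightarrow> x = 1"
  shows "word_vector ` lists alphabet = Z \<inter> positive_cone"
proof
  have "word_vector w \<in> Z" if "w \<in> lists alphabet" for w
    using that
    by (induction w rule: rev_induct)
      (simp_all add: e word_vector_Nil word_vector_snoc veech_invariant_sigma[OF Z])
  then show "word_vector ` lists alphabet \<subseteq> Z \<inter> positive_cone"
    using word_vector_positive_cone by auto
  have step: "\<sigma> *v v \<in> word_vector ` lists alphabet"
    if "v \<in> word_vector ` lists alphabet" "\<sigma> \<in> alphabet" for v \<sigma>
    using that by (auto simp flip: word_vector_snoc intro!: imageI)
  have "vector [x, y] \<in> word_vector ` lists alphabet"
    if "vector [x, y] \<in> Z" "x > 0" "y \<ge> 0" "x + y < real n * c" for x y n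
    using that
  proof (induction n arbitrary: x y)
    case (Suc n)
    show ?case
    proof (cases "y = 0")
      case True
      then have "vector [x, y] = word_vector []"
        using horizontal[of x] Suc.prems by (simp add: word_vector_Nil)
      then show ?thesis by (auto intro!: image_eqI[of _ _ "[]"])
    next
      case False
      then have y: "y > 0" using Suc.prems by simp
      have cx: "c \<le> x" using c(2)[OF Suc.prems(1)] Suc.prems(2) by simp
      have cy: "c \<le> y" using c(2)[OF veech_invariantD(2)[OF Z Suc.prems(1)]] y by simp
      \<comment> \<open>In the four cases the sum decreases by \<open>\<phi> * y\<close>,
        \<open>y + (2 - \<phi>) * x\<close>, \<open>x + (2 - \<phi>) * y\<close> and
        \<open>\<phi> * x\<close>. Each is at least \<open>c\<close>, as \<phi> is between 1 and 2
        and both coordinates are at least \<open>c\<close>.\<close>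
      have phi_xy: "x < \<phi> * x" "y < \<phi> * y" "\<phi> * x < 2 * x" "\<phi> * y < 2 * y"
        using y Suc.prems(2) phi_between_1_2 by simp_all
      have sum: "x + y < real n * c + c" using Suc.prems(4) by (simp add: algebra_simps)
      note inv = veech_invariant_sigma_inverse[OF Z Suc.prems(1)]
      consider "x > \<phi> * y" | "x \<le> \<phi> * y" "x > y" | "x \<le> y" "\<phi> * x > y" | "\<phi> * x \<le> y"
        by linarith
      then show ?thesis
      proof cases
        case 1
        have "vector [x - \<phi> * y, y] \<in> word_vector ` lists alphabet"
          by (rule Suc.IH[OF inv(1)]) (use 1 y phi_xy cy sum in linarith)+
        then show ?thesis using step sigma_inverse(1) by (metis alphabet_def insertI1)
      next
        case 2
        have "y * \<phi> < x * \<phi>" using 2 phi_between_1_2 by simp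
        then have "vector [\<phi> * x - \<phi> * y, \<phi> * y - x] \<in> word_vector ` lists alphabet"
          unfolding mult.commute[of _ \<phi>]
          by (intro Suc.IH[OF inv(2)]) (use 2 phi_xy cy sum in linarith)+
        then show ?thesis using step sigma_inverse(2) by (metis alphabet_def insertI1 insertI2)
      next
        case 3
        have "x * \<phi> \<le> y * \<phi>" using 3 phi_between_1_2 by simp
        then have "vector [\<phi> * x - y, \<phi> * y - \<phi> * x] \<in> word_vector ` lists alphabet"
          unfolding mult.commute[of _ \<phi>]
          by (intro Suc.IH[OF inv(3)]) (use 3 phi_xy cx sum in linarith)+
        then show ?thesis using step sigma_inverse(3) by (metis alphabet_def insertI1 insertI2)
      next
        case 4
        have "vector [x, y - \<phi> * x] \<in> word_vector ` lists alphabet"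
          by (rule Suc.IH[OF inv(4)]) (use 4 Suc.prems(2) phi_xy cx sum in linarith)+
        then show ?thesis using step sigma_inverse(4) by (metis alphabet_def insertI1 insertI2)
      qed
    qed
  qed simp
  moreover have "\<exists>n. v $ 1 + v $ 2 < real n * c" for v :: "real^2"
    using reals_Archimedean3[OF c(1)] by (simp add: mult.commute)
  ultimately show "Z \<inter> positive_cone \<subseteq> word_vector ` lists alphabet"
    using vector2_eta by (metis (mono_tags, lifting) IntE mem_Collect_eq positive_cone_def subsetI)
qed

section \<open>Application to holonomy vectors\<close>

lemma affine_automorphisms_veech_invariant:
  assumes "\<And>A pieces v. affine_automorphism A pieces \<Longrightarrow> v \<in> Z \<Longrightarrow> A v \<in> Z"
  shows "veech_invariant Z"
  unfolding veech_invariant_def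
  using assms[OF affine_automorphism_reflection] assms[OF affine_automorphism_swap]
    assms[OF affine_automorphism_shear] by blast

lemma veech_invariant_periodic_vectors: "veech_invariant periodic_vectors"
  by (rule affine_automorphisms_veech_invariant)
    (auto simp: periodic_vectors_def dest: affine_automorphism.periodic_trajectory_image)

lemma veech_invariant_saddle_vectors: "veech_invariant saddle_vectors"
  by (rule affine_automorphisms_veech_invariant)
    (auto simp: saddle_vectors_def dest: affine_automorphism.saddle_connection_image)

text \<open>For a generator \<open>g\<close>, if \<open>c\<close> times \<open>g v\<close> is in
  \<open>Z\<close>, then applying the inverse of \<open>g\<close> puts \<open>c\<close> times
  \<open>v\<close> in \<open>Z\<close>. The predicate \<open>P\<close> covers both
  \<open>shortest\<close> and \<open>longest\<close>.\<close>

lemma veech_invariant_extremal: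
  assumes "veech_invariant Z"
  shows "veech_invariant {v \<in> Z. \<forall>c>0. c *\<^sub>R v \<in> Z \<longrightarrow> P c}"
proof -
  have D: "vector [- v $ 1, v $ 2] \<in> Z" "vector [v $ 2, v $ 1] \<in> Z"
    "vector [v $ 1 + \<phi> * v $ 2, v $ 2] \<in> Z" "vector [v $ 1 - \<phi> * v $ 2, v $ 2] \<in> Z"
    if "v \<in> Z" for v
    using veech_invariantD[OF assms, of "v $ 1" "v $ 2"] that by (simp_all flip: vector2_eta)
  have "c *\<^sub>R v \<in> Z" if "c *\<^sub>R vector [- v $ 1, v $ 2] \<in> Z" for c v
  proof -
    have "c *\<^sub>R v = vector [- (- (c * v $ 1)), c * v $ 2]"
      by (simp add: vector2_eq_iff)
    then show ?thesis using D(1)[OF that] by simp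
  qed
  moreover have "c *\<^sub>R v \<in> Z" if "c *\<^sub>R vector [v $ 2, v $ 1] \<in> Z" for c v
  proof -
    have "c *\<^sub>R v = vector [c * v $ 1, c * v $ 2]"
      by (simp add: vector2_eq_iff)
    then show ?thesis using D(2)[OF that] by simp
  qed
  moreover have "c *\<^sub>R v \<in> Z" if "c *\<^sub>R vector [v $ 1 + \<phi> * v $ 2, v $ 2] \<in> Z" for c v
  proof -
    have "c *\<^sub>R v = vector [c * (v $ 1 + \<phi> * v $ 2) - \<phi> * (c * v $ 2), c * v $ 2]"
      by (simp add: vector2_eq_iff algebra_simps)
    then show ?thesis using D(4)[OF that] by simp
  qed
  ultimately show ?thesis
    unfolding veech_invariant_def using D by blast
qed

lemma word_vectors_eq_shortest:
  "word_vector ` lists alphabet = shortest periodic_vectors \<inter> positive_cone"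
proof (rule word_vectors_eq)
  have ge: "1 \<le> v $ 1" if "v \<in> periodic_vectors" "v $ 1 > 0" for v
    using that periodic_trajectory_coord_1_ge by (auto simp: periodic_vectors_def)
  have e: "vector [1, 0] \<in> periodic_vectors"
    using horizontal_periodic_trajectory by (auto simp: periodic_vectors_def)
  show "veech_invariant (shortest periodic_vectors)"
    unfolding shortest_def by (intro veech_invariant_extremal veech_invariant_periodic_vectors)
  show "vector [1, 0] \<in> shortest periodic_vectors"
    using e ge by (fastforce simp: shortest_def)
  show "1 \<le> v $ 1" if "v \<in> shortest periodic_vectors" "v $ 1 > 0" for v
    using that ge by (simp add: shortest_def)
  show "x = 1" if x: "x > 0" "vector [x, 0] \<in> shortest periodic_vectors" for x
  proof -
    have "(1 / x) *\<^sub>R vector [x, 0] = (vector [1, 0] :: real^2)"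
      using x(1) by (simp add: vector2_eq_iff)
    \<comment> \<open>Minimality against (1, 0) gives \<open>x \<le> 1\<close>; the bound for
      periodic trajectories gives the converse.\<close>
    then have "1 \<le> 1 / x" using x e by (simp add: shortest_def)
    moreover have "1 \<le> x" using x ge[of "vector [x, 0]"] by (simp add: shortest_def)
    ultimately show ?thesis using x(1) by simp
  qed
qed simp

lemma word_vectors_eq_longest:
  "word_vector ` lists alphabet = longest saddle_vectors \<inter> positive_cone"
proof (rule word_vectors_eq)
  have le: "x \<le> 1" if "vector [x, 0] \<in> saddle_vectors" "x > 0" for x
    using that horizontal_saddle_connection_le[of "vector [x, 0]"] by (auto simp: saddle_vectors_def)
  have e: "vector [1, 0] \<in> saddle_vectors"
    using horizontal_saddle_connection by (auto simp: saddle_vectors_def)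
  have scale: "c *\<^sub>R vector [x, 0] = (vector [c * x, 0] :: real^2)" for c x
    by (simp add: vector2_eq_iff)
  show "veech_invariant (longest saddle_vectors)"
    unfolding longest_def by (intro veech_invariant_extremal veech_invariant_saddle_vectors)
  show "vector [1, 0] \<in> longest saddle_vectors"
    using e le by (simp add: longest_def scale)
  \<comment> \<open>The smallest gap between values in \<open>grid\<close>, which is the length of
    the horizontal side from 1 to \<phi>.\<close>
  show "0 < \<phi> - 1" using phi_between_1_2 by simp
  show "\<phi> - 1 \<le> v $ 1" if "v \<in> longest saddle_vectors" "v $ 1 > 0" for v
    using that saddle_connection_coord_1_ge by (auto simp: longest_def saddle_vectors_def)
  show "x = 1" if x: "x > 0" "vector [x, 0] \<in> longest saddle_vectors" for x
  proof -
    have "1 / x \<le> 1" using x e by (simp add: longest_def scale)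
    moreover have "x \<le> 1" using x le by (simp add: longest_def)
    ultimately show ?thesis using x(1) by (simp add: field_simps)
  qed
qed

theorem theorem2p12:
  shows "word_vector ` lists alphabet = short_cylinder_vectors \<inter> positive_cone \<and>
         short_cylinder_vectors \<inter> positive_cone = long_saddle_connection_vectors \<inter> positive_cone \<and>
         bij_betw word_vector {w \<in> lists alphabet. w = [] \<or> hd w \<noteq> \<sigma>\<^sub>0}
           (short_cylinder_vectors \<inter> positive_cone)"
proof -
  have short: "word_vector ` lists alphabet = short_cylinder_vectors \<inter> positive_cone"
    using short_cylinder_vectors_eq unfolding word_vectors_eq_shortest
    by (auto simp: positive_cone_def)
  moreover have "word_vector ` lists alphabet = long_saddle_connection_vectors \<inter> positive_cone"
    by (simp add: word_vectors_eq_longest long_saddle_connection_vectors_eq)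
  moreover have "{w \<in> lists alphabet. w = [] \<or> hd w \<noteq> \<sigma>\<^sub>0} = {w. reduced_word w}"
    by (simp add: reduced_word_def)
  ultimately show ?thesis
    using word_vector_inj word_vector_reduced_image by (simp add: bij_betw_def)
qed

end
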